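(* Let $r\in\mathbb{N}$ and $n\ge 1$, and let $d_1,d_2,\ldots,d_n$ be positive integers such that $d_1\mid d_2\mid\cdots\mid d_n\mid r$. Then the generalized discrete Heisenberg group satisfies $$\mathrm{B}_0\big(H^{d_1|d_2|\cdots|d_n|r}_{2n+1}(\mathbb{Z}/r\mathbb{Z})\big)=0.$$
   Context: The generalized discrete Heisenberg group $H^{d_1|d_2|\cdots|d_n|r}_{2n+1}(\mathbb{Z}/r\mathbb{Z})$ is the set $(\mathbb{Z}/r\mathbb{Z})^{2n+1}$ with multiplication $$(a,b_1,\ldots,b_n,c_1,\ldots,c_n)(a',b_1',\ldots,b_n',c_1',\ldots,c_n')=\Big(a+a'+\sum_{i=1}^n d_ib_i'c_i,\ b_1+b_1',\ldots,b_n+b_n',\ c_1+c_1',\ldots,c_n+c_n'\Big).$$ For a finite group $G$, with $\mathbb{Q}/\mathbb{Z}$ a trivial $G$-module, the Bogomolov multiplier is $$\mathrm{B}_0(G)=\bigcap_{A\le G,\ A\text{ abelian}}\ker\big(\mathrm{res}^G_A: \mathrm{H}^2(G,\mathbb{Q}/\mathbb{Z})\to \mathrm{H}^2(A,\mathbb{Q}/\mathbb{Z})\big).$$ *)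

theory Defs
  imports "HOL-Algebra.Product_Groups" "HOL-Number_Theory.Cong"
begin

section \<open>The coefficient group\<close>

definition rat_group :: "rat monoid" where
  "rat_group = \<lparr>carrier = UNIV, monoid.mult = (+), one = 0\<rparr>"

definition QZ_group :: "rat set monoid" where
  "QZ_group = rat_group Mod \<int>"


section \<open>Second cohomology with trivial action\<close>

text \<open>
  We use inhomogeneous cochains with values in an abelian group \<open>M\<close> (written multiplicatively)
  on which \<open>G\<close> acts trivially. Cochains are extensional functions, so that two cochains
  are equal precisely if they agree on the carrier of \<open>G\<close>.
\<close>

definition cochains2 :: "('a, 'c) monoid_scheme \<Rightarrow> ('b, 'd) monoid_scheme \<Rightarrow> ('a \<times> 'a \<Rightarrow> 'b) monoid" where
  "cochains2 G M = product_group (carrier G \<times> carrier G) (\<lambda>_. M)"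

definition cocycles2 :: "('a, 'c) monoid_scheme \<Rightarrow> ('b, 'd) monoid_scheme \<Rightarrow> ('a \<times> 'a \<Rightarrow> 'b) set" where
  "cocycles2 G M = {f \<in> carrier (cochains2 G M).
     \<forall>x\<in>carrier G. \<forall>y\<in>carrier G. \<forall>z\<in>carrier G.
       f (y, z) \<otimes>\<^bsub>M\<^esub> f (x, y \<otimes>\<^bsub>G\<^esub> z) = f (x \<otimes>\<^bsub>G\<^esub> y, z) \<otimes>\<^bsub>M\<^esub> f (x, y)}"

definition coboundary1 ::
    "('a, 'c) monoid_scheme \<Rightarrow> ('b, 'd) monoid_scheme \<Rightarrow> ('a \<Rightarrow> 'b) \<Rightarrow> 'a \<times> 'a \<Rightarrow> 'b" where
  "coboundary1 G M \<phi> =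
     (\<lambda>(x, y)\<in>carrier G \<times> carrier G. \<phi> y \<otimes>\<^bsub>M\<^esub> inv\<^bsub>M\<^esub> (\<phi> (x \<otimes>\<^bsub>G\<^esub> y)) \<otimes>\<^bsub>M\<^esub> \<phi> x)"

definition coboundaries2 :: "('a, 'c) monoid_scheme \<Rightarrow> ('b, 'd) monoid_scheme \<Rightarrow> ('a \<times> 'a \<Rightarrow> 'b) set" where
  "coboundaries2 G M = coboundary1 G M ` (carrier G \<rightarrow>\<^sub>E carrier M)"

definition H2 :: "('a, 'c) monoid_scheme \<Rightarrow> ('b, 'd) monoid_scheme \<Rightarrow> ('a \<times> 'a \<Rightarrow> 'b) set monoid" where
  "H2 G M = (cochains2 G M)\<lparr>carrier := cocycles2 G M\<rparr> Mod coboundaries2 G M"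

text \<open>
  Elements of \<open>H2 G M\<close> are cosets of the group of coboundaries. All cocycles in one such coset
  restrict to the same coset on \<open>A\<close> (see \<open>res2_coset\<close> below); \<open>the_elem\<close> picks this common value.
\<close>

definition res2 ::
    "('a, 'c) monoid_scheme \<Rightarrow> 'a set \<Rightarrow> ('b, 'd) monoid_scheme \<Rightarrow> ('a \<times> 'a \<Rightarrow> 'b) set \<Rightarrow> ('a \<times> 'a \<Rightarrow> 'b) set" where
  "res2 G A M X = the_elem
     ((\<lambda>f. coboundaries2 (G\<lparr>carrier := A\<rparr>) M #>\<^bsub>cochains2 (G\<lparr>carrier := A\<rparr>) M\<^esub> restrict f (A \<times> A)) ` X)"


section \<open>The Bogomolov multiplier\<close>

definition bogomolov_multiplier :: "('a, 'c) monoid_scheme \<Rightarrow> ('a \<times> 'a \<Rightarrow> rat set) set set" where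
  "bogomolov_multiplier G =
     (\<Inter>A\<in>{A. subgroup A G \<and> comm_group (G\<lparr>carrier := A\<rparr>)}.
        kernel (H2 G QZ_group) (H2 (G\<lparr>carrier := A\<rparr>) QZ_group) (res2 G A QZ_group))"


section \<open>Generalized discrete Heisenberg groups\<close>

text \<open>
  The residue classes modulo \<open>r\<close> are represented by \<open>0, \<dots>, r - 1\<close>, as in \<^const>\<open>integer_mod_group\<close>;
  the tuples \<open>b\<close> and \<open>c\<close> are extensional functions on \<open>{1..n}\<close>.
\<close>

definition heisenberg_group ::
    "(nat \<Rightarrow> nat) \<Rightarrow> nat \<Rightarrow> nat \<Rightarrow> (int \<times> (nat \<Rightarrow> int) \<times> (nat \<Rightarrow> int)) monoid" where
  "heisenberg_group d n r =
     (let V = product_group {1..n} (\<lambda>_. integer_mod_group r) in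
      \<lparr>carrier = carrier (integer_mod_group r) \<times> carrier V \<times> carrier V,
       monoid.mult = (\<lambda>(a, b, c) (a', b', c').
         ((a + a' + (\<Sum>i=1..n. int (d i) * b' i * c i)) mod int r, b \<otimes>\<^bsub>V\<^esub> b', c \<otimes>\<^bsub>V\<^esub> c')),
       one = (0, \<one>\<^bsub>V\<^esub>, \<one>\<^bsub>V\<^esub>)\<rparr>)"


section \<open>Well-definedness\<close>

lemma comm_group_rat_group: "comm_group rat_group"
  unfolding rat_group_def
  by (rule comm_groupI) (auto intro: exI[of _ "- x" for x])

lemma subgroup_Ints_rat_group: "subgroup \<int> rat_group"
proof -
  interpret comm_group rat_group by (rule comm_group_rat_group)
  have "inv\<^bsub>rat_group\<^esub> x = - x" for x
    by (rule inv_equality) (auto simp: rat_group_def)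
  then show ?thesis
    by (intro subgroupI) (auto simp: rat_group_def)
qed

lemma comm_group_QZ_group: "comm_group QZ_group"
  unfolding QZ_group_def
  by (intro comm_group.abelian_FactGroup comm_group_rat_group subgroup_Ints_rat_group)

lemma comm_group_cochains2:
  assumes "comm_group M"
  shows "comm_group (cochains2 G M)"
proof -
  interpret M: comm_group M by fact
  show ?thesis
    unfolding cochains2_def
    by (rule group.group_comm_groupI) (auto simp: M.m_comm PiE_iff intro!: restrict_ext)
qed

lemma subgroup_cocycles2:
  assumes "group G" "comm_group M"
  shows "subgroup (cocycles2 G M) (cochains2 G M)"
proof -
  interpret G: group G by fact
  interpret M: comm_group M by fact
  interpret C: comm_group "cochains2 G M" by (rule comm_group_cochains2) fact
  have inv: "inv\<^bsub>cochains2 G M\<^esub> f = (\<lambda>p\<in>carrier G \<times> carrier G. inv\<^bsub>M\<^esub> f p)"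
    if "f \<in> carrier (cochains2 G M)" for f
    using that unfolding cochains2_def by (subst inv_product_group) auto
  have mem: "f p \<in> carrier M" if "f \<in> carrier (cochains2 G M)" "p \<in> carrier G \<times> carrier G" for f p
    using that by (auto simp: cochains2_def)
  show ?thesis
  proof (rule C.subgroupI)
    show "cocycles2 G M \<subseteq> carrier (cochains2 G M)"
      by (auto simp: cocycles2_def)
    have "\<one>\<^bsub>cochains2 G M\<^esub> \<in> cocycles2 G M"
      by (auto simp: cocycles2_def cochains2_def)
    then show "cocycles2 G M \<noteq> {}" by blast
  next
    fix f assume f: "f \<in> cocycles2 G M"
    then have fC: "f \<in> carrier (cochains2 G M)" by (simp add: cocycles2_def)
    show "inv\<^bsub>cochains2 G M\<^esub> f \<in> cocycles2 G M"
      using f C.inv_closed[OF fC]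
      by (auto simp: cocycles2_def inv[OF fC] mem[OF fC] simp flip: M.inv_mult)
  next
    fix f g assume f: "f \<in> cocycles2 G M" and g: "g \<in> cocycles2 G M"
    then have fC: "f \<in> carrier (cochains2 G M)" and gC: "g \<in> carrier (cochains2 G M)"
      by (simp_all add: cocycles2_def)
    have mult: "(f \<otimes>\<^bsub>cochains2 G M\<^esub> g) p = f p \<otimes>\<^bsub>M\<^esub> g p" if "p \<in> carrier G \<times> carrier G" for p
      using that by (simp add: cochains2_def)
    have interchange: "(a \<otimes>\<^bsub>M\<^esub> a') \<otimes>\<^bsub>M\<^esub> (b \<otimes>\<^bsub>M\<^esub> b') = (c \<otimes>\<^bsub>M\<^esub> c') \<otimes>\<^bsub>M\<^esub> (e \<otimes>\<^bsub>M\<^esub> e')"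
      if "a \<otimes>\<^bsub>M\<^esub> b = c \<otimes>\<^bsub>M\<^esub> e" "a' \<otimes>\<^bsub>M\<^esub> b' = c' \<otimes>\<^bsub>M\<^esub> e'" "{a, b, c, e, a', b', c', e'} \<subseteq> carrier M"
      for a b c e a' b' c' e'
    proof -
      have "(a \<otimes>\<^bsub>M\<^esub> a') \<otimes>\<^bsub>M\<^esub> (b \<otimes>\<^bsub>M\<^esub> b') = (a \<otimes>\<^bsub>M\<^esub> b) \<otimes>\<^bsub>M\<^esub> (a' \<otimes>\<^bsub>M\<^esub> b')"
        using that(3) by (simp add: M.m_ac)
      also have "\<dots> = (c \<otimes>\<^bsub>M\<^esub> c') \<otimes>\<^bsub>M\<^esub> (e \<otimes>\<^bsub>M\<^esub> e')"
        unfolding that(1,2) using that(3) by (simp add: M.m_ac)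
      finally show ?thesis .
    qed
    show "f \<otimes>\<^bsub>cochains2 G M\<^esub> g \<in> cocycles2 G M"
      using f g C.m_closed[OF fC gC]
      by (auto simp: cocycles2_def mult mem[OF fC] mem[OF gC] intro!: interchange)
  qed
qed

lemma comm_group_cocycles2:
  assumes "group G" "comm_group M"
  shows "comm_group ((cochains2 G M)\<lparr>carrier := cocycles2 G M\<rparr>)"
proof -
  interpret M: comm_group M by fact
  interpret C: comm_group "cochains2 G M" by (rule comm_group_cochains2) fact
  have sub: "subgroup (cocycles2 G M) (cochains2 G M)"
    by (rule subgroup_cocycles2) fact+
  show ?thesis
    by (rule group.group_comm_groupI[OF C.subgroup_imp_group[OF sub]])
      (use C.m_comm subgroup.subset[OF sub] in auto)
qed

lemma coboundary1_hom:
  assumes "group G" "comm_group M"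
  shows "coboundary1 G M \<in> hom (product_group (carrier G) (\<lambda>_. M))
           ((cochains2 G M)\<lparr>carrier := cocycles2 G M\<rparr>)"
proof -
  interpret G: group G by fact
  interpret M: comm_group M by fact
  show ?thesis
  proof (rule homI)
    fix \<phi> assume "\<phi> \<in> carrier (product_group (carrier G) (\<lambda>_. M))"
    then have \<phi>: "\<phi> x \<in> carrier M" if "x \<in> carrier G" for x using that by auto
    have "\<phi> z \<otimes>\<^bsub>M\<^esub> inv\<^bsub>M\<^esub> (\<phi> (y \<otimes>\<^bsub>G\<^esub> z)) \<otimes>\<^bsub>M\<^esub> \<phi> y \<otimes>\<^bsub>M\<^esub>
        (\<phi> (y \<otimes>\<^bsub>G\<^esub> z) \<otimes>\<^bsub>M\<^esub> inv\<^bsub>M\<^esub> (\<phi> (x \<otimes>\<^bsub>G\<^esub> (y \<otimes>\<^bsub>G\<^esub> z))) \<otimes>\<^bsub>M\<^esub> \<phi> x) =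
        \<phi> z \<otimes>\<^bsub>M\<^esub> inv\<^bsub>M\<^esub> (\<phi> (x \<otimes>\<^bsub>G\<^esub> y \<otimes>\<^bsub>G\<^esub> z)) \<otimes>\<^bsub>M\<^esub> \<phi> (x \<otimes>\<^bsub>G\<^esub> y) \<otimes>\<^bsub>M\<^esub>
        (\<phi> y \<otimes>\<^bsub>M\<^esub> inv\<^bsub>M\<^esub> (\<phi> (x \<otimes>\<^bsub>G\<^esub> y)) \<otimes>\<^bsub>M\<^esub> \<phi> x)"
      if xyz: "x \<in> carrier G" "y \<in> carrier G" "z \<in> carrier G" for x y z
    proof -
      have cancel: "u \<otimes>\<^bsub>M\<^esub> (inv\<^bsub>M\<^esub> u \<otimes>\<^bsub>M\<^esub> v) = v" "inv\<^bsub>M\<^esub> u \<otimes>\<^bsub>M\<^esub> (u \<otimes>\<^bsub>M\<^esub> v) = v"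
        if "u \<in> carrier M" "v \<in> carrier M" for u v
        using that by (simp_all flip: M.m_assoc)
      let ?p = "\<phi> x" and ?q = "\<phi> y" and ?s = "\<phi> z" and ?t = "inv\<^bsub>M\<^esub> \<phi> (x \<otimes>\<^bsub>G\<^esub> (y \<otimes>\<^bsub>G\<^esub> z))"
      have *: "s \<otimes>\<^bsub>M\<^esub> inv\<^bsub>M\<^esub> u \<otimes>\<^bsub>M\<^esub> q \<otimes>\<^bsub>M\<^esub> (u \<otimes>\<^bsub>M\<^esub> t \<otimes>\<^bsub>M\<^esub> p) = s \<otimes>\<^bsub>M\<^esub> (q \<otimes>\<^bsub>M\<^esub> (t \<otimes>\<^bsub>M\<^esub> p))"
        "s \<otimes>\<^bsub>M\<^esub> t \<otimes>\<^bsub>M\<^esub> u \<otimes>\<^bsub>M\<^esub> (q \<otimes>\<^bsub>M\<^esub> inv\<^bsub>M\<^esub> u \<otimes>\<^bsub>M\<^esub> p) = s \<otimes>\<^bsub>M\<^esub> (q \<otimes>\<^bsub>M\<^esub> (t \<otimes>\<^bsub>M\<^esub> p))"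
        if "p \<in> carrier M" "q \<in> carrier M" "s \<in> carrier M" "t \<in> carrier M" "u \<in> carrier M"
        for p q s t u
        using that by (simp_all add: M.m_lcomm[of _ u] M.m_lcomm[of _ "inv\<^bsub>M\<^esub> u"] M.m_assoc cancel)
          (simp add: M.m_lcomm)
      show ?thesis
        using xyz by (simp add: * \<phi> G.m_assoc)
    qed
    then show "coboundary1 G M \<phi> \<in> carrier ((cochains2 G M)\<lparr>carrier := cocycles2 G M\<rparr>)"
      by (auto simp: coboundary1_def cocycles2_def cochains2_def \<phi>)
  next
    fix \<phi> \<psi> assume "\<phi> \<in> carrier (product_group (carrier G) (\<lambda>_. M))"
      "\<psi> \<in> carrier (product_group (carrier G) (\<lambda>_. M))"
    then have \<phi>: "\<phi> x \<in> carrier M" "\<psi> x \<in> carrier M" if "x \<in> carrier G" for x using that by auto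
    show "coboundary1 G M (\<phi> \<otimes>\<^bsub>product_group (carrier G) (\<lambda>_. M)\<^esub> \<psi>) =
        coboundary1 G M \<phi> \<otimes>\<^bsub>(cochains2 G M)\<lparr>carrier := cocycles2 G M\<rparr>\<^esub> coboundary1 G M \<psi>"
      by (auto simp: coboundary1_def cochains2_def \<phi> fun_eq_iff M.inv_mult M.m_ac)
  qed
qed

lemma subgroup_coboundaries2:
  assumes "group G" "comm_group M"
  shows "subgroup (coboundaries2 G M) ((cochains2 G M)\<lparr>carrier := cocycles2 G M\<rparr>)"
proof -
  interpret M: comm_group M by fact
  interpret Z: comm_group "(cochains2 G M)\<lparr>carrier := cocycles2 G M\<rparr>"
    by (rule comm_group_cocycles2) fact+
  interpret group_hom "product_group (carrier G) (\<lambda>_. M)"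
      "(cochains2 G M)\<lparr>carrier := cocycles2 G M\<rparr>" "coboundary1 G M"
    by (intro group_hom.intro group_hom_axioms.intro coboundary1_hom assms product_group Z.is_group
        M.is_group)
  show ?thesis
    using img_is_subgroup by (simp add: coboundaries2_def)
qed

lemma comm_group_H2:
  assumes "group G" "comm_group M"
  shows "comm_group (H2 G M)"
  unfolding H2_def
  by (intro comm_group.abelian_FactGroup comm_group_cocycles2 subgroup_coboundaries2 assms)

lemma restrict_cocycles2:
  assumes "group G" "subgroup A G" "f \<in> cocycles2 G M"
  shows "restrict f (A \<times> A) \<in> cocycles2 (G\<lparr>carrier := A\<rparr>) M"
proof -
  have "A \<subseteq> carrier G" "\<And>x y. x \<in> A \<Longrightarrow> y \<in> A \<Longrightarrow> x \<otimes>\<^bsub>G\<^esub> y \<in> A"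
    using assms(2) by (auto simp: subgroup_def)
  with assms(3) show ?thesis
    by (auto simp: cocycles2_def cochains2_def subset_iff PiE_iff)
qed

lemma restrict_coboundaries2:
  assumes "group G" "subgroup A G" "f \<in> coboundaries2 G M"
  shows "restrict f (A \<times> A) \<in> coboundaries2 (G\<lparr>carrier := A\<rparr>) M"
proof -
  have A: "A \<subseteq> carrier G" "\<And>x y. x \<in> A \<Longrightarrow> y \<in> A \<Longrightarrow> x \<otimes>\<^bsub>G\<^esub> y \<in> A"
    using assms(2) by (auto simp: subgroup_def)
  from assms(3) obtain \<phi> where \<phi>: "\<phi> \<in> carrier G \<rightarrow>\<^sub>E carrier M" "f = coboundary1 G M \<phi>"
    by (auto simp: coboundaries2_def)
  have "restrict f (A \<times> A) = coboundary1 (G\<lparr>carrier := A\<rparr>) M (restrict \<phi> A)"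
    using A by (auto simp: \<phi>(2) coboundary1_def fun_eq_iff)
  moreover have "restrict \<phi> A \<in> A \<rightarrow>\<^sub>E carrier M"
    using A \<phi>(1) by auto
  ultimately show ?thesis
    by (auto simp: coboundaries2_def)
qed

lemma res2_coset:
  assumes "group G" "subgroup A G" "comm_group M" "f \<in> cocycles2 G M"
  shows "res2 G A M (coboundaries2 G M #>\<^bsub>cochains2 G M\<^esub> f) =
    coboundaries2 (G\<lparr>carrier := A\<rparr>) M #>\<^bsub>cochains2 (G\<lparr>carrier := A\<rparr>) M\<^esub> restrict f (A \<times> A)"
proof -
  let ?A = "G\<lparr>carrier := A\<rparr>"
  interpret M: comm_group M by fact
  have A: "A \<subseteq> carrier G" and gA: "group ?A"
    using assms(1,2) by (auto simp: subgroup_def intro: subgroup.subgroup_is_group)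
  let ?Z = "(cochains2 ?A M)\<lparr>carrier := cocycles2 ?A M\<rparr>"
  interpret Z: comm_group ?Z by (rule comm_group_cocycles2[OF gA]) fact
  have sub: "subgroup (coboundaries2 ?A M) ?Z"
    by (rule subgroup_coboundaries2[OF gA]) fact
  have coset: "H #>\<^bsub>?Z\<^esub> x = H #>\<^bsub>cochains2 ?A M\<^esub> x" for H x
    by (simp add: r_coset_def)
  have eq: "coboundaries2 ?A M #>\<^bsub>cochains2 ?A M\<^esub> restrict g (A \<times> A) =
      coboundaries2 ?A M #>\<^bsub>cochains2 ?A M\<^esub> restrict f (A \<times> A)"
    if g: "g \<in> coboundaries2 G M #>\<^bsub>cochains2 G M\<^esub> f" for g
  proof -
    from g obtain h where h: "h \<in> coboundaries2 G M" "g = h \<otimes>\<^bsub>cochains2 G M\<^esub> f"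
      by (auto simp: r_coset_def)
    have "restrict g (A \<times> A) = restrict h (A \<times> A) \<otimes>\<^bsub>?Z\<^esub> restrict f (A \<times> A)"
      using A by (auto simp: h(2) cochains2_def fun_eq_iff)
    then have "restrict g (A \<times> A) \<in> coboundaries2 ?A M #>\<^bsub>?Z\<^esub> restrict f (A \<times> A)"
      using restrict_coboundaries2[OF assms(1,2) h(1)] by (auto simp: r_coset_def)
    from Z.repr_independence[OF this _ sub] restrict_cocycles2[OF assms(1,2,4)]
    show ?thesis by (simp add: coset)
  qed
  have ne: "coboundaries2 G M #>\<^bsub>cochains2 G M\<^esub> f \<noteq> {}"
    using subgroup.one_closed[OF subgroup_coboundaries2[OF assms(1,3)]] by (auto simp: r_coset_def)
  show ?thesis
    unfolding res2_def using ne eq by (subst the_elem_image_unique) auto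
qed

lemma res2_hom:
  assumes "group G" "subgroup A G" "comm_group M"
  shows "res2 G A M \<in> hom (H2 G M) (H2 (G\<lparr>carrier := A\<rparr>) M)"
proof -
  let ?A = "G\<lparr>carrier := A\<rparr>"
  let ?ZG = "(cochains2 G M)\<lparr>carrier := cocycles2 G M\<rparr>"
  let ?ZA = "(cochains2 ?A M)\<lparr>carrier := cocycles2 ?A M\<rparr>"
  have A: "A \<subseteq> carrier G" and gA: "group ?A"
    using assms(1,2) by (auto simp: subgroup_def intro: subgroup.subgroup_is_group)
  interpret ZG: comm_group ?ZG by (rule comm_group_cocycles2) fact+
  interpret ZA: comm_group ?ZA by (rule comm_group_cocycles2[OF gA]) fact
  interpret NG: normal "coboundaries2 G M" ?ZG
    by (rule ZG.subgroup_imp_normal[OF subgroup_coboundaries2]) fact+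
  interpret NA: normal "coboundaries2 ?A M" ?ZA
    by (rule ZA.subgroup_imp_normal[OF subgroup_coboundaries2[OF gA]]) fact
  have res: "res2 G A M (coboundaries2 G M #>\<^bsub>?ZG\<^esub> f) = coboundaries2 ?A M #>\<^bsub>?ZA\<^esub> restrict f (A \<times> A)"
    if "f \<in> cocycles2 G M" for f
    using res2_coset[OF assms that] by (simp add: r_coset_def)
  have restr: "restrict f (A \<times> A) \<in> carrier ?ZA" if "f \<in> cocycles2 G M" for f
    using restrict_cocycles2[OF assms(1,2) that] by simp
  show ?thesis
  proof (rule homI)
    fix X assume "X \<in> carrier (H2 G M)"
    then obtain f where f: "f \<in> cocycles2 G M" "X = coboundaries2 G M #>\<^bsub>?ZG\<^esub> f"
      by (auto simp: H2_def FactGroup_def RCOSETS_def)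
    show "res2 G A M X \<in> carrier (H2 ?A M)"
      using restr[OF f(1)] unfolding f(2) res[OF f(1)] by (auto simp: H2_def FactGroup_def RCOSETS_def)
  next
    fix X Y assume "X \<in> carrier (H2 G M)" "Y \<in> carrier (H2 G M)"
    then obtain f g where f: "f \<in> cocycles2 G M" "X = coboundaries2 G M #>\<^bsub>?ZG\<^esub> f"
      and g: "g \<in> cocycles2 G M" "Y = coboundaries2 G M #>\<^bsub>?ZG\<^esub> g"
      by (auto simp: H2_def FactGroup_def RCOSETS_def)
    have fg: "f \<otimes>\<^bsub>?ZG\<^esub> g \<in> cocycles2 G M"
      using ZG.m_closed[of f g] f(1) g(1) by simp
    have "restrict (f \<otimes>\<^bsub>?ZG\<^esub> g) (A \<times> A) = restrict f (A \<times> A) \<otimes>\<^bsub>?ZA\<^esub> restrict g (A \<times> A)"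
      using A by (auto simp: cochains2_def fun_eq_iff)
    moreover have "X <#>\<^bsub>?ZG\<^esub> Y = coboundaries2 G M #>\<^bsub>?ZG\<^esub> (f \<otimes>\<^bsub>?ZG\<^esub> g)"
      unfolding f(2) g(2) using f(1) g(1) by (intro NG.rcos_sum) simp_all
    ultimately show "res2 G A M (X \<otimes>\<^bsub>H2 G M\<^esub> Y) = res2 G A M X \<otimes>\<^bsub>H2 ?A M\<^esub> res2 G A M Y"
      using res[OF fg] NA.rcos_sum[OF restr[OF f(1)] restr[OF g(1)]]
      unfolding H2_def FactGroup_def f(2) g(2) monoid.simps res[OF f(1)] res[OF g(1)] by metis
  qed
qed

lemma finite_heisenberg_group:
  assumes "r > 0"
  shows "finite (carrier (heisenberg_group d n r))"
  using assms by (auto simp: heisenberg_group_def carrier_integer_mod_group intro!: finite_PiE)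

lemma group_heisenberg_group:
  assumes "r > 0"
  shows "group (heisenberg_group d n r)"
proof -
  let ?Z = "integer_mod_group r"
  let ?V = "product_group {1..n} (\<lambda>_. ?Z)"
  let ?H = "heisenberg_group d n r"
  interpret V: group ?V by simp
  define s where "s = (\<lambda>b c :: nat \<Rightarrow> int. \<Sum>i=1..n. int (d i) * b i * c i)"
  have l: "[s (b \<otimes>\<^bsub>?V\<^esub> b') c = s b c + s b' c] (mod int r)" for b b' c
    unfolding s_def sum.distrib[symmetric]
  proof (rule cong_sum)
    fix i assume "i \<in> {1..n}"
    then have "[(b \<otimes>\<^bsub>?V\<^esub> b') i = b i + b' i] (mod int r)"
      by (simp add: cong_def)
    from cong_scalar_right[OF cong_scalar_left[OF this, of "int (d i)"], of "c i"]
    show "[int (d i) * (b \<otimes>\<^bsub>?V\<^esub> b') i * c i =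
        int (d i) * b i * c i + int (d i) * b' i * c i] (mod int r)"
      by (simp only: distrib_left distrib_right)
  qed
  have rr: "[s b (c \<otimes>\<^bsub>?V\<^esub> c') = s b c + s b c'] (mod int r)" for b c c'
    unfolding s_def sum.distrib[symmetric]
  proof (rule cong_sum)
    fix i assume "i \<in> {1..n}"
    then have "[(c \<otimes>\<^bsub>?V\<^esub> c') i = c i + c' i] (mod int r)"
      by (simp add: cong_def)
    from cong_scalar_left[OF this, of "int (d i) * b i"]
    show "[int (d i) * b i * (c \<otimes>\<^bsub>?V\<^esub> c') i =
        int (d i) * b i * c i + int (d i) * b i * c' i] (mod int r)"
      by (simp only: distrib_left)
  qed
  have carr: "carrier ?H = {0..<int r} \<times> carrier ?V \<times> carrier ?V"
    using assms by (simp add: heisenberg_group_def carrier_integer_mod_group)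
  have mult: "(a, b, c) \<otimes>\<^bsub>?H\<^esub> (a', b', c') =
      ((a + a' + s b' c) mod int r, b \<otimes>\<^bsub>?V\<^esub> b', c \<otimes>\<^bsub>?V\<^esub> c')" for a b c a' b' c'
    by (simp add: heisenberg_group_def s_def Let_def)
  have one: "\<one>\<^bsub>?H\<^esub> = (0, \<one>\<^bsub>?V\<^esub>, \<one>\<^bsub>?V\<^esub>)"
    by (simp add: heisenberg_group_def Let_def)
  have s0: "s b \<one>\<^bsub>?V\<^esub> = 0" for b
    by (simp add: s_def)
  note [simp del] = One_nat_def mult_product_group one_product_group carrier_product_group
  show ?thesis
  proof (rule groupI)
    fix x y assume "x \<in> carrier ?H" "y \<in> carrier ?H"
    then show "x \<otimes>\<^bsub>?H\<^esub> y \<in> carrier ?H"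
      using assms by (cases x; cases y) (auto simp: carr mult)
  next
    show "\<one>\<^bsub>?H\<^esub> \<in> carrier ?H"
      using assms by (auto simp: carr one)
  next
    fix x y z assume xyz: "x \<in> carrier ?H" "y \<in> carrier ?H" "z \<in> carrier ?H"
    obtain a b c a' b' c' a'' b'' c'' where
      eq: "x = (a, b, c)" "y = (a', b', c')" "z = (a'', b'', c'')"
      by (metis prod_cases3)
    have "[a + a' + s b' c + a'' + s b'' (c \<otimes>\<^bsub>?V\<^esub> c') =
        a + a' + s b' c + a'' + (s b'' c + s b'' c')] (mod int r)"
      by (intro cong_add rr cong_refl)
    also have "a + a' + s b' c + a'' + (s b'' c + s b'' c') =
        a + (a' + a'' + s b'' c') + (s b' c + s b'' c)" by simp
    also have "[\<dots> = a + (a' + a'' + s b'' c') + s (b' \<otimes>\<^bsub>?V\<^esub> b'') c] (mod int r)"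
      by (intro cong_add cong_sym[OF l] cong_refl)
    finally show "x \<otimes>\<^bsub>?H\<^esub> y \<otimes>\<^bsub>?H\<^esub> z = x \<otimes>\<^bsub>?H\<^esub> (y \<otimes>\<^bsub>?H\<^esub> z)"
      using xyz mod_add_left_eq[of "a + a' + s b' c" "int r" "a'' + s b'' (c \<otimes>\<^bsub>?V\<^esub> c')"]
        mod_add_left_eq[of "a' + a'' + s b'' c'" "int r" "a + s (b' \<otimes>\<^bsub>?V\<^esub> b'') c"]
      by (auto simp: eq carr mult V.m_assoc cong_def algebra_simps)
  next
    fix x assume "x \<in> carrier ?H"
    then show "\<one>\<^bsub>?H\<^esub> \<otimes>\<^bsub>?H\<^esub> x = x"
      by (cases x) (auto simp: carr mult one s0)
  next
    fix x assume x: "x \<in> carrier ?H"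
    obtain a b c where eq: "x = (a, b, c)" by (metis prod_cases3)
    let ?y = "((- a - s b (inv\<^bsub>?V\<^esub> c)) mod int r, inv\<^bsub>?V\<^esub> b, inv\<^bsub>?V\<^esub> c)"
    have "?y \<in> carrier ?H" "?y \<otimes>\<^bsub>?H\<^esub> x = \<one>\<^bsub>?H\<^esub>"
      using x assms mod_add_left_eq[of "- a - s b (inv\<^bsub>?V\<^esub> c)" "int r" "a + s b (inv\<^bsub>?V\<^esub> c)"]
      by (auto simp: eq carr mult one add.assoc simp del: inv_product_group)
    then show "\<exists>y\<in>carrier ?H. y \<otimes>\<^bsub>?H\<^esub> x = \<one>\<^bsub>?H\<^esub>" by blast
  qed
qed

end

theory Submission
  imports Defs "HOL-Algebra.Zassenhaus" "HOL-Algebra.Multiplicative_Group"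
begin

text \<open>
  Let \<open>w\<close> be a cocycle that is trivial on abelian subgroups. Then \<open>w (x, y) = w (y, x)\<close> whenever
  \<open>x\<close> and \<open>y\<close> commute, so in the central extension \<open>E\<close> of \<open>G\<close> by \<open>\<rat>/\<int>\<close> given by \<open>w\<close>, lifts of commuting
  elements commute. Let \<open>e\<close> and \<open>f\<close> be the elements of the Heisenberg group with \<open>b\<^sub>1 = 1\<close> and \<open>c\<^sub>1 = 1\<close>,
  respectively, and all other coordinates zero. As \<open>d\<^sub>1\<close> divides every \<open>d\<^sub>i\<close>, any \<open>x\<close> and \<open>y\<close> can be
  made to commute by multiplying them by powers of \<open>e\<close> and \<open>f\<close>. Hence the commutator \<open>t\<close> of lifts of
  \<open>e\<close> and \<open>f\<close>, which is central in \<open>E\<close>, generates \<open>[E, E]\<close>. If \<open>t\<^sup>m\<close> lies in the kernel \<open>\<rat>/\<int>\<close>, then \<open>e\<^sup>m\<close> and \<open>f\<close>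
  commute, hence so do their lifts, and \<open>t\<^sup>m = 1\<close>; so \<open>[E, E]\<close> meets the kernel trivially. Since \<open>\<rat>/\<int>\<close> is divisible, a
  maximal subgroup that contains \<open>[E, E]\<close> and meets \<open>\<rat>/\<int>\<close> trivially is a complement of \<open>\<rat>/\<int>\<close>, and \<open>w\<close> is a
  coboundary.
\<close>

section \<open>Complements of central divisible kernels\<close>

text \<open>Division with remainder: the remainder of \<open>j\<close> modulo \<open>m\<close> is
  again an exponent whose power lies in \<open>U\<close>, and it is smaller than \<open>m\<close>,
  hence zero.\<close>

lemma (in group) dvd_of_least_pow:
  fixes j :: int
  assumes "subgroup U G" "x \<in> carrier G" "x [^] m \<in> U" "m > 0"
    and least: "\<And>i. 0 < i \<Longrightarrow> i < m \<Longrightarrow> x [^] (i::nat) \<notin> U"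
    and "x [^] j \<in> U"
  shows "int m dvd j"
proof (rule ccontr)
  assume "\<not> int m dvd j"
  then have "j mod int m \<noteq> 0" "j mod int m \<ge> 0"
    using \<open>m > 0\<close> by (auto intro: mod_0_imp_dvd)
  then have pos: "0 < nat (j mod int m)" by simp
  have "x [^] (j mod int m) = x [^] j \<otimes> inv ((x [^] int m) [^] (j div int m))"
    using assms(2) by (simp add: int_pow_pow int_pow_diff[symmetric] minus_mult_div_eq_mod)
  also have "\<dots> \<in> U"
    using assms(1,6) subgroup_int_pow_closed[OF assms(1,3), of "j div int m"]
    by (simp add: int_pow_int subgroup.m_closed subgroup.m_inv_closed)
  finally have "x [^] nat (j mod int m) \<in> U"
    using \<open>m > 0\<close> by (simp flip: int_pow_int)
  moreover have "nat (j mod int m) < m"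
    using \<open>m > 0\<close> by (simp add: nat_less_iff)
  ultimately show False
    using least pos by blast
qed

text \<open>A conjugate of \<open>s\<close> by \<open>x\<close> is the commutator of
  \<open>x\<close> and \<open>s\<close> times \<open>s\<close>.\<close>

lemma (in group) normal_of_commutators:
  assumes "subgroup S G"
    and "\<And>x y. x \<in> carrier G \<Longrightarrow> y \<in> carrier G \<Longrightarrow> x \<otimes> y \<otimes> inv x \<otimes> inv y \<in> S"
  shows "S \<lhd> G"
  unfolding normal_inv_iff
proof (intro conjI ballI assms(1))
  fix x s assume x: "x \<in> carrier G" and s: "s \<in> S"
  then have "s \<in> carrier G"
    using assms(1) subgroup.mem_carrier by fast
  then have "x \<otimes> s \<otimes> inv x = x \<otimes> s \<otimes> inv x \<otimes> inv s \<otimes> s"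
    using x by (simp add: m_assoc)
  then show "x \<otimes> s \<otimes> inv x \<in> S"
    using assms x s \<open>s \<in> carrier G\<close> by (metis subgroup.m_closed)
qed

text \<open>Take a largest subgroup that contains \<open>T\<close> and meets the kernel trivially.
  Divisibility allows any \<open>x\<close> to be corrected by a central kernel element so that
  adjoining the result creates no new kernel element. Maximality then places the corrected element,
  which has the same image as \<open>x\<close>, in the subgroup already.\<close>

lemma (in group_hom) central_divisible_kernel_complement:
  assumes fin: "finite (carrier H)" and surj: "h ` carrier G = carrier H"
    and central: "\<And>k x. k \<in> kernel G H h \<Longrightarrow> x \<in> carrier G \<Longrightarrow> k \<otimes> x = x \<otimes> k"
    and divisible: "\<And>k m. k \<in> kernel G H h \<Longrightarrow> m > 0 \<Longrightarrow> \<exists>l\<in>kernel G H h. l [^] (m::nat) = k"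
    and T: "subgroup T G" "T \<inter> kernel G H h = {\<one>}"
    and comm: "\<And>x y. x \<in> carrier G \<Longrightarrow> y \<in> carrier G \<Longrightarrow> x \<otimes> y \<otimes> inv x \<otimes> inv y \<in> T"
  shows "\<exists>S. subgroup S G \<and> bij_betw h S (carrier H)"
proof -
  let ?K = "kernel G H h"
  define P where "P S \<longleftrightarrow> subgroup S G \<and> T \<subseteq> S \<and> S \<inter> ?K = {\<one>}" for S
  have inj: "inj_on h S" if "P S" for S
  proof (rule inj_onI)
    fix x y assume xy: "x \<in> S" "y \<in> S" "h x = h y"
    interpret S: subgroup S G using that by (simp add: P_def)
    have "x \<otimes> inv y \<in> S \<inter> ?K"
      using xy by (simp add: kernel_def)
    then have "x \<otimes> inv y = \<one>"
      using that by (auto simp: P_def)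
    then show "x = y"
      using xy G.inv_solve_right[of \<one> x y] by simp
  qed
  have bound: "finite S \<and> card S \<le> card (carrier H)" if "P S" for S
  proof -
    have "h ` S \<subseteq> carrier H"
      using that subgroup.subset by (fastforce simp: P_def)
    then show ?thesis
      using inj[OF that] fin by (meson card_inj_on_le inj_on_finite)
  qed
  have "P T"
    using T by (simp add: P_def)
  \<comment> \<open>Although \<open>G\<close> may be infinite, all candidates embed into the finite
    \<open>H\<close>, so maximality can be measured by cardinality and Zorn's lemma is
    avoided.\<close>
  from ex_has_greatest_nat[of P T card, OF this] bound
  obtain S where S: "P S" and max: "\<And>S'. P S' \<Longrightarrow> card S' \<le> card S"
    by (metis less_Suc_eq_le)
  interpret S: subgroup S G using S by (simp add: P_def)
  have SK: "s = \<one>" if "s \<in> S" "s \<in> ?K" for s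
    using S that by (auto simp: P_def)
  \<comment> \<open>\<open>S\<close> contains \<open>T\<close>, hence all commutators. Normality is
    what makes the product with a cyclic group below a subgroup.\<close>
  have normal: "S \<lhd> G"
    using S comm by (intro G.normal_of_commutators) (auto simp: P_def)
  have U: "subgroup (h ` S) H"
    by (rule subgroup_img_is_subgroup) (rule S.subgroup_axioms)
  have "h x \<in> h ` S" if x: "x \<in> carrier G" for x
  proof -
    \<comment> \<open>The order of \<open>H\<close> is one positive exponent that brings
      \<open>h x\<close> into the image of \<open>S\<close>; \<open>m\<close> is the least, that is,
      the order of \<open>h x\<close> modulo that image.\<close>
    have "h x [^]\<^bsub>H\<^esub> order H \<in> h ` S" "order H > 0"
      using x fin U H.pow_order_eq_1[of "h x"] by (simp_all add: subgroup.one_closed H.order_gt_0_iff_finite)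
    then obtain m where m: "0 < m" "h x [^]\<^bsub>H\<^esub> m \<in> h ` S"
      and least: "\<And>i. 0 < i \<Longrightarrow> i < m \<Longrightarrow> h x [^]\<^bsub>H\<^esub> (i::nat) \<notin> h ` S"
      using exists_least_iff[of "\<lambda>m. 0 < m \<and> h x [^]\<^bsub>H\<^esub> (m::nat) \<in> h ` S"] by metis
    obtain s where s: "s \<in> S" "h x [^]\<^bsub>H\<^esub> m = h s"
      using m(2) by blast
    then have "inv s \<otimes> x [^] m \<in> ?K"
      using x by (simp add: kernel_def hom_nat_pow)
    from divisible[OF this m(1)] obtain l where
      l: "l \<in> ?K" "l [^] m = inv s \<otimes> x [^] m" by blast
    have lG: "l \<in> carrier G" "h l = \<one>\<^bsub>H\<^esub>"
      using l(1) by (simp_all add: kernel_def)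
    \<comment> \<open>dividing \<open>x\<close> by an \<open>m\<close>-th root \<open>l\<close> of \<open>s\<inverse> x\<^sup>m\<close> makes its \<open>m\<close>-th power lie in \<open>S\<close>\<close>
    define y where "y = x \<otimes> inv l"
    have yG: "y \<in> carrier G" and hy: "h y = h x"
      using x lG by (simp_all add: y_def)
    have xy: "x = y \<otimes> l"
      using x lG by (simp add: y_def G.m_assoc)
    have "x [^] m = y [^] m \<otimes> l [^] m"
      unfolding xy using yG lG central[OF l(1) yG] by (intro G.pow_mult_distrib) simp_all
    then have "y [^] m \<otimes> l [^] m = s \<otimes> l [^] m"
      using l(2) x s by (simp add: G.m_assoc[symmetric])
    then have ym: "y [^] m = s"
      using s yG lG G.right_cancel[of "l [^] m" "y [^] m" s] by simp
    \<comment> \<open>The enlargement of \<open>S\<close> by \<open>y\<close>; it turns out to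
      satisfy \<open>P\<close>, so it equals \<open>S\<close>.\<close>
    let ?S = "S <#> generate G {y}"
    have gen: "generate G {y} = {y [^] j | j. j \<in> (UNIV :: int set)}"
      by (rule G.generate_pow[OF yG])
    have sub: "subgroup ?S G"
      by (intro G.mult_norm_subgroup normal G.generate_is_subgroup) (use yG in simp)
    have "s \<otimes> \<one> \<in> ?S" if "s \<in> S" for s
      using that generate.one[of G "{y}"] unfolding set_mult_def by blast
    then have "S \<subseteq> ?S" by auto
    have "\<one> \<otimes> y \<in> ?S"
      using generate.incl[of y "{y}" G] S.one_closed unfolding set_mult_def by blast
    then have "y \<in> ?S" using yG by simp
    \<comment> \<open>If \<open>u\<close> times the \<open>j\<close>-th power of \<open>y\<close> is
      in the kernel, then the \<open>j\<close>-th power of \<open>h x\<close> lies in the image of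
      \<open>S\<close>, so \<open>m\<close> divides \<open>j\<close>. The power of \<open>y\<close>
      is then a power of \<open>s\<close>, so the element lies in \<open>S\<close>, where only the
      identity is in the kernel.\<close>
    have "g = \<one>" if g: "g \<in> ?S" "g \<in> ?K" for g
    proof -
      obtain u j where u: "u \<in> S" "g = u \<otimes> y [^] (j::int)"
        using g(1) unfolding set_mult_def gen by blast
      have "h u \<otimes>\<^bsub>H\<^esub> h x [^]\<^bsub>H\<^esub> j = \<one>\<^bsub>H\<^esub>"
        using g(2) u yG hy by (simp add: kernel_def hom_int_pow)
      then have "inv\<^bsub>H\<^esub> (h x [^]\<^bsub>H\<^esub> j) = h u"
        using u x by (intro H.inv_equality) simp_all
      then have "h x [^]\<^bsub>H\<^esub> j = h (inv u)"
        using u x H.inv_inv[of "h x [^]\<^bsub>H\<^esub> j"] by simp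
      then have "h x [^]\<^bsub>H\<^esub> j \<in> h ` S"
        using S.m_inv_closed[OF u(1)] by (metis imageI)
      then have "int m dvd j"
        using H.dvd_of_least_pow[OF U _ m(2,1) least] x by simp
      then obtain q where q: "j = int m * q" by blast
      have "y [^] j = (y [^] int m) [^] q"
        using yG by (simp add: q G.int_pow_pow)
      then have "y [^] j = s [^] q"
        by (simp add: int_pow_int ym)
      then have "g \<in> S"
        using u s G.subgroup_int_pow_closed[OF S.subgroup_axioms s(1)] by simp
      then show ?thesis
        using SK g(2) by blast
    qed
    moreover have "\<one> \<in> ?S \<inter> ?K"
      using sub by (simp add: subgroup.one_closed kernel_def)
    ultimately have "P ?S"
      using S sub \<open>S \<subseteq> ?S\<close> by (auto simp: P_def)
    then have "?S = S"
      using max bound \<open>S \<subseteq> ?S\<close> by (metis card_seteq)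
    then show ?thesis
      using \<open>y \<in> ?S\<close> hy by (metis imageI)
  qed
  then have "carrier H \<subseteq> h ` S"
    unfolding surj[symmetric] by (rule image_subsetI)
  moreover have "h ` S \<subseteq> carrier H"
    using S.mem_carrier by (intro image_subsetI hom_closed)
  ultimately have "h ` S = carrier H" by blast
  then show ?thesis
    using inj[OF S] S.subgroup_axioms by (auto simp: bij_betw_def)
qed

section \<open>Commutators in groups with an adjusting pair\<close>

text \<open>
  With this condition, commuting \<open>e\<close> and \<open>f\<close> force the whole group to be commutative; it will be applied to
  the quotient of the central extension by the subgroup generated by the commutator of \<open>e\<close> and \<open>f\<close>.
\<close>

definition adjusting_pair :: "('a, 'b) monoid_scheme \<Rightarrow> 'a \<Rightarrow> 'a \<Rightarrow> bool" where
  "adjusting_pair G e f \<longleftrightarrow> e \<in> carrier G \<and> f \<in> carrier G \<and>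
     (\<forall>x\<in>carrier G. \<exists>i::nat. x \<otimes>\<^bsub>G\<^esub> e [^]\<^bsub>G\<^esub> i \<otimes>\<^bsub>G\<^esub> f = f \<otimes>\<^bsub>G\<^esub> (x \<otimes>\<^bsub>G\<^esub> e [^]\<^bsub>G\<^esub> i)) \<and>
     (\<forall>x\<in>carrier G. \<exists>j::nat. x \<otimes>\<^bsub>G\<^esub> f [^]\<^bsub>G\<^esub> j \<otimes>\<^bsub>G\<^esub> e = e \<otimes>\<^bsub>G\<^esub> (x \<otimes>\<^bsub>G\<^esub> f [^]\<^bsub>G\<^esub> j)) \<and>
     (\<forall>x\<in>carrier G. \<forall>y\<in>carrier G. \<exists>(i::nat) (j::nat).
        x \<otimes>\<^bsub>G\<^esub> e [^]\<^bsub>G\<^esub> i \<otimes>\<^bsub>G\<^esub> (y \<otimes>\<^bsub>G\<^esub> f [^]\<^bsub>G\<^esub> j) = y \<otimes>\<^bsub>G\<^esub> f [^]\<^bsub>G\<^esub> j \<otimes>\<^bsub>G\<^esub> (x \<otimes>\<^bsub>G\<^esub> e [^]\<^bsub>G\<^esub> i))"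

lemma (in group_hom) adjusting_pair_image:
  assumes "adjusting_pair G e f" and surj: "h ` carrier G = carrier H"
  shows "adjusting_pair H (h e) (h f)"
proof -
  have ef: "e \<in> carrier G" "f \<in> carrier G"
    using assms(1) by (auto simp: adjusting_pair_def)
  show ?thesis
    unfolding adjusting_pair_def surj[symmetric] ball_simps
  proof (intro conjI ballI)
    fix x assume x: "x \<in> carrier G"
    show "\<exists>i::nat. h x \<otimes>\<^bsub>H\<^esub> h e [^]\<^bsub>H\<^esub> i \<otimes>\<^bsub>H\<^esub> h f = h f \<otimes>\<^bsub>H\<^esub> (h x \<otimes>\<^bsub>H\<^esub> h e [^]\<^bsub>H\<^esub> i)"
      using assms(1) x ef unfolding adjusting_pair_def
      by (metis G.m_closed G.nat_pow_closed hom_mult hom_nat_pow)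
    show "\<exists>j::nat. h x \<otimes>\<^bsub>H\<^esub> h f [^]\<^bsub>H\<^esub> j \<otimes>\<^bsub>H\<^esub> h e = h e \<otimes>\<^bsub>H\<^esub> (h x \<otimes>\<^bsub>H\<^esub> h f [^]\<^bsub>H\<^esub> j)"
      using assms(1) x ef unfolding adjusting_pair_def
      by (metis G.m_closed G.nat_pow_closed hom_mult hom_nat_pow)
    fix y assume y: "y \<in> carrier G"
    obtain i j :: nat where "x \<otimes> e [^] i \<otimes> (y \<otimes> f [^] j) = y \<otimes> f [^] j \<otimes> (x \<otimes> e [^] i)"
      using assms(1) x y unfolding adjusting_pair_def by blast
    from arg_cong[OF this, of h]
    show "\<exists>(i::nat) (j::nat). h x \<otimes>\<^bsub>H\<^esub> h e [^]\<^bsub>H\<^esub> i \<otimes>\<^bsub>H\<^esub> (h y \<otimes>\<^bsub>H\<^esub> h f [^]\<^bsub>H\<^esub> j) =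
        h y \<otimes>\<^bsub>H\<^esub> h f [^]\<^bsub>H\<^esub> j \<otimes>\<^bsub>H\<^esub> (h x \<otimes>\<^bsub>H\<^esub> h e [^]\<^bsub>H\<^esub> i)"
      using x y ef by (auto simp: hom_nat_pow)
  qed (use ef in simp_all)
qed

text \<open>The exponents that work for the images also work upstairs, since \<open>lift\<close>
  turns commuting images into commuting elements.\<close>

lemma (in group_hom) adjusting_pair_lift:
  assumes "adjusting_pair H (h e) (h f)" and ef: "e \<in> carrier G" "f \<in> carrier G"
    and lift: "\<And>x y. x \<in> carrier G \<Longrightarrow> y \<in> carrier G \<Longrightarrow>
      h x \<otimes>\<^bsub>H\<^esub> h y = h y \<otimes>\<^bsub>H\<^esub> h x \<Longrightarrow> x \<otimes> y = y \<otimes> x"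
  shows "adjusting_pair G e f"
  unfolding adjusting_pair_def
proof (intro conjI ballI ef)
  fix x assume x: "x \<in> carrier G"
  obtain i :: nat where "h x \<otimes>\<^bsub>H\<^esub> h e [^]\<^bsub>H\<^esub> i \<otimes>\<^bsub>H\<^esub> h f = h f \<otimes>\<^bsub>H\<^esub> (h x \<otimes>\<^bsub>H\<^esub> h e [^]\<^bsub>H\<^esub> i)"
    using assms(1) x unfolding adjusting_pair_def by (meson hom_closed)
  then show "\<exists>i::nat. x \<otimes> e [^] i \<otimes> f = f \<otimes> (x \<otimes> e [^] i)"
    using x ef by (intro exI lift) (auto simp: hom_nat_pow)
  obtain j :: nat where "h x \<otimes>\<^bsub>H\<^esub> h f [^]\<^bsub>H\<^esub> j \<otimes>\<^bsub>H\<^esub> h e = h e \<otimes>\<^bsub>H\<^esub> (h x \<otimes>\<^bsub>H\<^esub> h f [^]\<^bsub>H\<^esub> j)"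
    using assms(1) x unfolding adjusting_pair_def by (meson hom_closed)
  then show "\<exists>j::nat. x \<otimes> f [^] j \<otimes> e = e \<otimes> (x \<otimes> f [^] j)"
    using x ef by (intro exI lift) (auto simp: hom_nat_pow)
  fix y assume y: "y \<in> carrier G"
  obtain i j :: nat where "h x \<otimes>\<^bsub>H\<^esub> h e [^]\<^bsub>H\<^esub> i \<otimes>\<^bsub>H\<^esub> (h y \<otimes>\<^bsub>H\<^esub> h f [^]\<^bsub>H\<^esub> j) =
      h y \<otimes>\<^bsub>H\<^esub> h f [^]\<^bsub>H\<^esub> j \<otimes>\<^bsub>H\<^esub> (h x \<otimes>\<^bsub>H\<^esub> h e [^]\<^bsub>H\<^esub> i)"
    using assms(1) x y unfolding adjusting_pair_def by (meson hom_closed)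
  then show "\<exists>(i::nat) (j::nat). x \<otimes> e [^] i \<otimes> (y \<otimes> f [^] j) = y \<otimes> f [^] j \<otimes> (x \<otimes> e [^] i)"
    using x y ef by (intro exI lift) (auto simp: hom_nat_pow)
qed

lemma (in group) subgroup_centralizer:
  assumes "B \<subseteq> carrier G"
  shows "subgroup {x \<in> carrier G. \<forall>b\<in>B. x \<otimes> b = b \<otimes> x} G"
proof (rule subgroupI)
  fix x assume "x \<in> {x \<in> carrier G. \<forall>b\<in>B. x \<otimes> b = b \<otimes> x}"
  then have x: "x \<in> carrier G" "\<And>b. b \<in> B \<Longrightarrow> x \<otimes> b = b \<otimes> x" by auto
  have "inv x \<otimes> b = b \<otimes> inv x" if "b \<in> B" for b
  proof -
    have b: "b \<in> carrier G" using assms that by blast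
    then have "x \<otimes> (b \<otimes> inv x) = b"
      using x(1) by (simp add: x(2)[OF that] m_assoc flip: m_assoc[of x b])
    then show ?thesis
      using x(1) b by (simp add: inv_solve_left')
  qed
  then show "inv x \<in> {x \<in> carrier G. \<forall>b\<in>B. x \<otimes> b = b \<otimes> x}"
    using x(1) by simp
next
  fix x y assume "x \<in> {x \<in> carrier G. \<forall>b\<in>B. x \<otimes> b = b \<otimes> x}" "y \<in> {x \<in> carrier G. \<forall>b\<in>B. x \<otimes> b = b \<otimes> x}"
  then show "x \<otimes> y \<in> {x \<in> carrier G. \<forall>b\<in>B. x \<otimes> b = b \<otimes> x}"
    using assms by (auto simp: subset_iff) (metis m_assoc)
qed (use assms in \<open>auto simp: subset_iff intro!: exI[of _ \<one>]\<close>)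

lemma (in group) commute_cancel_right:
  assumes "a \<in> carrier G" "u \<in> carrier G" "b \<in> carrier G"
    and "a \<otimes> u \<otimes> b = b \<otimes> (a \<otimes> u)" and "u \<otimes> b = b \<otimes> u"
  shows "a \<otimes> b = b \<otimes> a"
proof -
  have "a \<otimes> b \<otimes> u = b \<otimes> a \<otimes> u"
    using assms by (simp add: m_assoc)
  then show ?thesis
    using assms by simp
qed

text \<open>Since \<open>e\<close> and \<open>f\<close> commute, the correcting powers can be
  cancelled from the first two conditions, so \<open>f\<close> and \<open>e\<close> are central.
  Both powers can then be cancelled from the third condition.\<close>

lemma (in group) comm_group_if_commuting_adjusting_pair:
  assumes "adjusting_pair G e f" and ef: "e \<otimes> f = f \<otimes> e"
  shows "comm_group G"
proof -
  have carr: "e \<in> carrier G" "f \<in> carrier G"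
    using assms(1) by (auto simp: adjusting_pair_def)
  have f: "x \<otimes> f = f \<otimes> x" if "x \<in> carrier G" for x
  proof -
    obtain i :: nat where "x \<otimes> e [^] i \<otimes> f = f \<otimes> (x \<otimes> e [^] i)"
      using assms(1) \<open>x \<in> carrier G\<close> unfolding adjusting_pair_def by blast
    then show ?thesis
      using that carr ef by (intro commute_cancel_right[of x "e [^] i"]) (auto intro: group_commutes_pow)
  qed
  have e: "x \<otimes> e = e \<otimes> x" if "x \<in> carrier G" for x
  proof -
    obtain i :: nat where "x \<otimes> f [^] i \<otimes> e = e \<otimes> (x \<otimes> f [^] i)"
      using assms(1) \<open>x \<in> carrier G\<close> unfolding adjusting_pair_def by blast
    then show ?thesis
      using that carr ef by (intro commute_cancel_right[of x "f [^] i"]) (auto intro: group_commutes_pow)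
  qed
  have "x \<otimes> y = y \<otimes> x" if xy: "x \<in> carrier G" "y \<in> carrier G" for x y
  proof -
    obtain i j :: nat where "x \<otimes> e [^] i \<otimes> (y \<otimes> f [^] j) = y \<otimes> f [^] j \<otimes> (x \<otimes> e [^] i)"
      using assms(1) xy unfolding adjusting_pair_def by blast
    then have "x \<otimes> (y \<otimes> f [^] j) = y \<otimes> f [^] j \<otimes> x"
      using xy carr by (intro commute_cancel_right[of x "e [^] i"]) (auto intro: group_commutes_pow simp: e)
    then have "y \<otimes> x = x \<otimes> y"
      using xy carr by (intro commute_cancel_right[of y "f [^] j"]) (auto intro: group_commutes_pow simp: f)
    then show ?thesis by simp
  qed
  then show ?thesis
    by (intro group.group_comm_groupI is_group) auto
qed

text \<open>Each factor \<open>e\<close> that moves past \<open>f\<close> releases one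
  \<open>t\<close>, which can be collected in front because it is central.\<close>

lemma (in group) pow_mult_eq_commutator_pow:
  assumes "e \<in> carrier G" "f \<in> carrier G" "t \<in> carrier G"
    and "e \<otimes> f = t \<otimes> (f \<otimes> e)" and central: "\<And>x. x \<in> carrier G \<Longrightarrow> t \<otimes> x = x \<otimes> t"
  shows "e [^] (m::nat) \<otimes> f = t [^] m \<otimes> (f \<otimes> e [^] m)"
proof (induction m)
  case (Suc m)
  have "e [^] Suc m \<otimes> f = (e [^] m \<otimes> t) \<otimes> (f \<otimes> e)"
    using assms by (simp add: m_assoc)
  also have "\<dots> = t \<otimes> (e [^] m \<otimes> f) \<otimes> e"
    using assms(1-3) by (simp add: m_assoc flip: central)
  also have "\<dots> = (t \<otimes> t [^] m) \<otimes> (f \<otimes> e [^] Suc m)"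
    using assms(1-3) by (simp add: Suc m_assoc)
  also have "t \<otimes> t [^] m = t [^] Suc m"
    using assms(3) by (simp add: central)
  finally show ?case .
qed (use assms in simp)

text \<open>If a power of \<open>t\<close> is in the kernel, the same power of \<open>e\<close>
  commutes with \<open>f\<close> in \<open>H\<close>, hence in \<open>G\<close>, and the power of
  \<open>t\<close> is trivial. Modulo the group generated by \<open>t\<close>, the elements
  \<open>e\<close> and \<open>f\<close> commute and still form an adjusting pair, so the quotient is
  commutative.\<close>

lemma (in group_hom) commutators_in_lifted_commutator:
  assumes adj: "adjusting_pair H (h e) (h f)" and ef: "e \<in> carrier G" "f \<in> carrier G"
    and surj: "h ` carrier G = carrier H"
    and lift: "\<And>x y. x \<in> carrier G \<Longrightarrow> y \<in> carrier G \<Longrightarrow>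
      h x \<otimes>\<^bsub>H\<^esub> h y = h y \<otimes>\<^bsub>H\<^esub> h x \<Longrightarrow> x \<otimes> y = y \<otimes> x"
    and t_def: "t = e \<otimes> f \<otimes> inv e \<otimes> inv f"
    and t_central: "\<And>x. x \<in> carrier H \<Longrightarrow> h t \<otimes>\<^bsub>H\<^esub> x = x \<otimes>\<^bsub>H\<^esub> h t"
  shows "generate G {t} \<inter> kernel G H h = {\<one>}"
    and "x \<in> carrier G \<Longrightarrow> y \<in> carrier G \<Longrightarrow> x \<otimes> y \<otimes> inv x \<otimes> inv y \<in> generate G {t}"
proof -
  let ?T = "generate G {t}"
  have t: "t \<in> carrier G"
    using ef by (simp add: t_def)
  \<comment> \<open>Centrality of \<open>h t\<close> in \<open>H\<close> lifts to centrality of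
    \<open>t\<close> in \<open>G\<close>.\<close>
  have central: "t \<otimes> x = x \<otimes> t" if "x \<in> carrier G" for x
    using that t t_central by (intro lift) auto
  have eft: "e \<otimes> f = t \<otimes> (f \<otimes> e)"
    using ef by (simp add: t_def G.m_assoc G.inv_solve_left')
  have sub: "subgroup ?T G"
    using t by (intro G.generate_is_subgroup) simp
  have T: "?T = {t [^] k | k. k \<in> (UNIV :: int set)}"
    by (rule G.generate_pow[OF t])
  have pow: "t [^] m = \<one>" if "h (t [^] m) = \<one>\<^bsub>H\<^esub>" for m :: nat
  proof -
    have eq: "e [^] m \<otimes> f = t [^] m \<otimes> (f \<otimes> e [^] m)"
      by (rule G.pow_mult_eq_commutator_pow) (use ef t eft central in auto)
    have "h (e [^] m \<otimes> f) = h (f \<otimes> e [^] m)"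
      unfolding eq using that ef t by simp
    then have "e [^] m \<otimes> f = f \<otimes> e [^] m"
      using ef by (intro lift) auto
    then show ?thesis
      using eq ef t G.l_cancel_one[of "f \<otimes> e [^] m" "t [^] m"] by simp
  qed
  show "?T \<inter> kernel G H h = {\<one>}"
  proof (intro equalityI subsetI)
    fix g assume "g \<in> ?T \<inter> kernel G H h"
    then obtain k :: int where k: "g = t [^] k" "h g = \<one>\<^bsub>H\<^esub>"
      unfolding T by (auto simp: kernel_def)
    have "g = \<one>"
    proof (cases "k \<ge> 0")
      case True
      then show ?thesis
        using k pow[of "nat k"] t by (simp flip: int_pow_int)
    next
      case False
      then have "g = inv (t [^] nat (- k))"
        using k t by (simp flip: int_pow_int add: G.int_pow_neg)
      then show ?thesis
        using k(2) pow[of "nat (- k)"] t by simp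
    qed
    then show "g \<in> {\<one>}" by simp
  qed (use sub in \<open>auto simp: kernel_def subgroup.one_closed\<close>)
  \<comment> \<open>The center, as the centralizer of the whole carrier, is a subgroup containing
    \<open>t\<close>.\<close>
  have gc: "g \<otimes> x = x \<otimes> g" if "g \<in> ?T" "x \<in> carrier G" for g x
    using that central t
      G.generate_subgroup_incl[OF _ G.subgroup_centralizer[OF subset_refl], of "{t}"]
    by blast
  have normal: "?T \<lhd> G"
    unfolding G.normal_inv_iff
  proof (intro conjI ballI sub)
    fix x g assume x: "x \<in> carrier G" and g: "g \<in> ?T"
    then have "x \<otimes> g \<otimes> inv x = g"
      using subgroup.mem_carrier[OF sub g] by (simp add: gc[symmetric] G.m_assoc)
    then show "x \<otimes> g \<otimes> inv x \<in> ?T"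
      using g by simp
  qed
  interpret N: normal ?T G by (rule normal)
  interpret Q: group_hom G "G Mod ?T" "\<lambda>x. ?T #> x"
    by (intro group_hom.intro group_hom_axioms.intro G.is_group N.factorgroup_is_group N.r_coset_hom_Mod)
  have "?T #> t = ?T"
    by (rule G.coset_join2[OF t sub]) (simp add: generate.incl)
  have "comm_group (G Mod ?T)"
  proof (rule Q.H.comm_group_if_commuting_adjusting_pair)
    show "adjusting_pair (G Mod ?T) (?T #> e) (?T #> f)"
      by (rule Q.adjusting_pair_image[OF adjusting_pair_lift[OF adj ef lift]])
        (auto simp: carrier_FactGroup)
    \<comment> \<open>As \<open>t\<close> becomes trivial in the quotient, \<open>eft\<close> turns
      into the commutation of the images of \<open>e\<close> and \<open>f\<close>.\<close>
    have "?T #> (e \<otimes> f) = (?T #> t) \<otimes>\<^bsub>G Mod ?T\<^esub> (?T #> (f \<otimes> e))"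
      unfolding eft using t ef Q.hom_mult by simp
    also have "?T #> t = \<one>\<^bsub>G Mod ?T\<^esub>"
      using \<open>?T #> t = ?T\<close> by simp
    finally show "(?T #> e) \<otimes>\<^bsub>G Mod ?T\<^esub> (?T #> f) = (?T #> f) \<otimes>\<^bsub>G Mod ?T\<^esub> (?T #> e)"
      using ef Q.hom_closed by (simp del: mult_FactGroup one_FactGroup flip: Q.hom_mult)
  qed
  then interpret Q: comm_group "G Mod ?T" .
  show "x \<otimes> y \<otimes> inv x \<otimes> inv y \<in> ?T" if xy: "x \<in> carrier G" "y \<in> carrier G"
  proof -
    have "?T #> (x \<otimes> y) = ?T #> (y \<otimes> x)"
      using xy Q.m_comm[of "?T #> x" "?T #> y"] Q.hom_closed
      by (simp del: mult_FactGroup flip: Q.hom_mult)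
    then have "x \<otimes> y \<in> ?T #> (y \<otimes> x)"
      using xy G.rcos_self[OF _ sub, of "x \<otimes> y"] by simp
    then obtain u where u: "u \<in> ?T" "x \<otimes> y = u \<otimes> (y \<otimes> x)"
      by (auto simp: r_coset_def)
    then have "x \<otimes> y \<otimes> inv x \<otimes> inv y = u"
      using xy subgroup.mem_carrier[OF sub u(1)] by (simp add: G.m_assoc)
    then show ?thesis using u(1) by simp
  qed
qed

section \<open>Central extensions defined by cocycles\<close>

text \<open>Cocycles are not assumed to be normalized, whence the inverse of the value at the pair
  of identities in the neutral element.\<close>

definition central_extension ::
    "('a, 'c) monoid_scheme \<Rightarrow> ('b, 'd) monoid_scheme \<Rightarrow> ('a \<times> 'a \<Rightarrow> 'b) \<Rightarrow> ('b \<times> 'a) monoid" where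
  "central_extension G M f =
     \<lparr>carrier = carrier M \<times> carrier G,
      monoid.mult = (\<lambda>(k, x) (l, y). (k \<otimes>\<^bsub>M\<^esub> l \<otimes>\<^bsub>M\<^esub> f (x, y), x \<otimes>\<^bsub>G\<^esub> y)),
      one = (inv\<^bsub>M\<^esub> f (\<one>\<^bsub>G\<^esub>, \<one>\<^bsub>G\<^esub>), \<one>\<^bsub>G\<^esub>)\<rparr>"

lemma central_extension_simps [simp]:
  "carrier (central_extension G M f) = carrier M \<times> carrier G"
  "(k, x) \<otimes>\<^bsub>central_extension G M f\<^esub> (l, y) = (k \<otimes>\<^bsub>M\<^esub> l \<otimes>\<^bsub>M\<^esub> f (x, y), x \<otimes>\<^bsub>G\<^esub> y)"
  "\<one>\<^bsub>central_extension G M f\<^esub> = (inv\<^bsub>M\<^esub> f (\<one>\<^bsub>G\<^esub>, \<one>\<^bsub>G\<^esub>), \<one>\<^bsub>G\<^esub>)"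
  by (simp_all add: central_extension_def)

lemma cocycles2_closed:
  assumes "f \<in> cocycles2 G M" "x \<in> carrier G" "y \<in> carrier G"
  shows "f (x, y) \<in> carrier M"
  using assms by (auto simp: cocycles2_def cochains2_def)

lemma cocycles2_eq:
  assumes "f \<in> cocycles2 G M" "x \<in> carrier G" "y \<in> carrier G" "z \<in> carrier G"
  shows "f (y, z) \<otimes>\<^bsub>M\<^esub> f (x, y \<otimes>\<^bsub>G\<^esub> z) = f (x \<otimes>\<^bsub>G\<^esub> y, z) \<otimes>\<^bsub>M\<^esub> f (x, y)"
  using assms by (auto simp: cocycles2_def)

text \<open>The cocycle identity at \<open>(1, 1, x)\<close>, with a common factor
  cancelled.\<close>

lemma cocycles2_one_left:
  assumes "group G" "comm_group M" and f: "f \<in> cocycles2 G M" and x: "x \<in> carrier G"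
  shows "f (\<one>\<^bsub>G\<^esub>, x) = f (\<one>\<^bsub>G\<^esub>, \<one>\<^bsub>G\<^esub>)"
proof -
  interpret G: group G by fact
  interpret M: comm_group M by fact
  show ?thesis
    using cocycles2_eq[OF f G.one_closed G.one_closed x] x cocycles2_closed[OF f] by simp
qed

text \<open>Associativity of the product amounts to the cocycle identity.\<close>

lemma group_central_extension:
  assumes "group G" "comm_group M" and f: "f \<in> cocycles2 G M"
  shows "group (central_extension G M f)"
proof -
  interpret G: group G by fact
  interpret M: comm_group M by fact
  note [simp] = cocycles2_closed[OF f]
  show ?thesis
  proof (rule groupI)
    fix p q s
    assume "p \<in> carrier (central_extension G M f)" "q \<in> carrier (central_extension G M f)"
      "s \<in> carrier (central_extension G M f)"
    then obtain k x l y m z where eq: "p = (k, x)" "q = (l, y)" "s = (m, z)"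
      and carr: "k \<in> carrier M" "l \<in> carrier M" "m \<in> carrier M"
        "x \<in> carrier G" "y \<in> carrier G" "z \<in> carrier G"
      by auto
    have "k \<otimes>\<^bsub>M\<^esub> l \<otimes>\<^bsub>M\<^esub> f (x, y) \<otimes>\<^bsub>M\<^esub> m \<otimes>\<^bsub>M\<^esub> f (x \<otimes>\<^bsub>G\<^esub> y, z) =
        k \<otimes>\<^bsub>M\<^esub> l \<otimes>\<^bsub>M\<^esub> m \<otimes>\<^bsub>M\<^esub> (f (x \<otimes>\<^bsub>G\<^esub> y, z) \<otimes>\<^bsub>M\<^esub> f (x, y))"
      using carr by (simp add: M.m_ac)
    also have "\<dots> = k \<otimes>\<^bsub>M\<^esub> l \<otimes>\<^bsub>M\<^esub> m \<otimes>\<^bsub>M\<^esub> (f (y, z) \<otimes>\<^bsub>M\<^esub> f (x, y \<otimes>\<^bsub>G\<^esub> z))"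
      using cocycles2_eq[OF f] carr by simp
    also have "\<dots> = k \<otimes>\<^bsub>M\<^esub> (l \<otimes>\<^bsub>M\<^esub> m \<otimes>\<^bsub>M\<^esub> f (y, z)) \<otimes>\<^bsub>M\<^esub> f (x, y \<otimes>\<^bsub>G\<^esub> z)"
      using carr by (simp add: M.m_assoc)
    finally show "p \<otimes>\<^bsub>central_extension G M f\<^esub> q \<otimes>\<^bsub>central_extension G M f\<^esub> s =
        p \<otimes>\<^bsub>central_extension G M f\<^esub> (q \<otimes>\<^bsub>central_extension G M f\<^esub> s)"
      using carr by (simp add: eq G.m_assoc)
  next
    fix p assume "p \<in> carrier (central_extension G M f)"
    then obtain k x where eq: "p = (k, x)" and carr: "k \<in> carrier M" "x \<in> carrier G" by auto
    show "\<one>\<^bsub>central_extension G M f\<^esub> \<otimes>\<^bsub>central_extension G M f\<^esub> p = p"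
      using carr by (simp add: eq cocycles2_one_left[OF assms carr(2)] M.m_ac)
    \<comment> \<open>Used for the left inverse, with \<open>a\<close> the value of \<open>f\<close>
      at the pair of the inverse of \<open>x\<close> and \<open>x\<close>, and \<open>b\<close> the
      first component of the neutral element.\<close>
    have "inv\<^bsub>M\<^esub> k \<otimes>\<^bsub>M\<^esub> inv\<^bsub>M\<^esub> a \<otimes>\<^bsub>M\<^esub> b \<otimes>\<^bsub>M\<^esub> k \<otimes>\<^bsub>M\<^esub> a = b" if "a \<in> carrier M" "b \<in> carrier M" for a b
    proof -
      have "inv\<^bsub>M\<^esub> k \<otimes>\<^bsub>M\<^esub> inv\<^bsub>M\<^esub> a \<otimes>\<^bsub>M\<^esub> b \<otimes>\<^bsub>M\<^esub> k \<otimes>\<^bsub>M\<^esub> a = (inv\<^bsub>M\<^esub> k \<otimes>\<^bsub>M\<^esub> k) \<otimes>\<^bsub>M\<^esub> (inv\<^bsub>M\<^esub> a \<otimes>\<^bsub>M\<^esub> a) \<otimes>\<^bsub>M\<^esub> b"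
        using that carr by (simp only: M.m_ac M.inv_closed M.m_closed)
      then show ?thesis
        using that carr by simp
    qed
    then have "(inv\<^bsub>M\<^esub> k \<otimes>\<^bsub>M\<^esub> inv\<^bsub>M\<^esub> f (inv\<^bsub>G\<^esub> x, x) \<otimes>\<^bsub>M\<^esub> inv\<^bsub>M\<^esub> f (\<one>\<^bsub>G\<^esub>, \<one>\<^bsub>G\<^esub>), inv\<^bsub>G\<^esub> x) \<otimes>\<^bsub>central_extension G M f\<^esub> p =
        \<one>\<^bsub>central_extension G M f\<^esub>"
      using carr by (simp add: eq)
    then show "\<exists>q\<in>carrier (central_extension G M f).
        q \<otimes>\<^bsub>central_extension G M f\<^esub> p = \<one>\<^bsub>central_extension G M f\<^esub>"
      using carr by (intro bexI) auto
  qed auto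
qed

text \<open>\<open>S\<close> is the graph of a function \<open>\<phi>\<close> on \<open>G\<close>,
  and closure under products says that \<open>f\<close> measures the failure of
  \<open>\<phi>\<close> to be multiplicative.\<close>

lemma cocycle_is_coboundary_if_section:
  assumes "comm_group M" and f: "f \<in> cocycles2 G M"
    and S: "bij_betw snd S (carrier G)" "S \<subseteq> carrier (central_extension G M f)"
    and mult: "\<And>p q. p \<in> S \<Longrightarrow> q \<in> S \<Longrightarrow> p \<otimes>\<^bsub>central_extension G M f\<^esub> q \<in> S"
    and "group G"
  shows "f \<in> coboundaries2 G M"
proof -
  interpret G: group G by fact
  interpret M: comm_group M by fact
  define \<phi> where "\<phi> x = fst (inv_into S snd x)" for x
  have \<phi>: "(\<phi> x, x) \<in> S" if "x \<in> carrier G" for x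
    using that S(1) f_inv_into_f[of x snd S] inv_into_into[of x snd S]
    by (auto simp: \<phi>_def bij_betw_def) (metis prod.collapse)
  then have carr: "\<phi> x \<in> carrier M" if "x \<in> carrier G" for x
    using that S(2) by auto
  have \<phi>_mult: "\<phi> (x \<otimes>\<^bsub>G\<^esub> y) = \<phi> x \<otimes>\<^bsub>M\<^esub> \<phi> y \<otimes>\<^bsub>M\<^esub> f (x, y)" if "x \<in> carrier G" "y \<in> carrier G" for x y
  proof -
    have "(\<phi> x \<otimes>\<^bsub>M\<^esub> \<phi> y \<otimes>\<^bsub>M\<^esub> f (x, y), x \<otimes>\<^bsub>G\<^esub> y) \<in> S"
      using mult[OF \<phi>[OF that(1)] \<phi>[OF that(2)]] by simp
    from inj_onD[OF bij_betw_imp_inj_on[OF S(1)] _ \<phi> this] that show ?thesis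
      by simp
  qed
  have cancel: "inv\<^bsub>M\<^esub> b \<otimes>\<^bsub>M\<^esub> (a \<otimes>\<^bsub>M\<^esub> b \<otimes>\<^bsub>M\<^esub> c) \<otimes>\<^bsub>M\<^esub> inv\<^bsub>M\<^esub> a = c"
    if "a \<in> carrier M" "b \<in> carrier M" "c \<in> carrier M" for a b c
  proof -
    have "inv\<^bsub>M\<^esub> b \<otimes>\<^bsub>M\<^esub> (a \<otimes>\<^bsub>M\<^esub> b \<otimes>\<^bsub>M\<^esub> c) \<otimes>\<^bsub>M\<^esub> inv\<^bsub>M\<^esub> a =
        (inv\<^bsub>M\<^esub> b \<otimes>\<^bsub>M\<^esub> b) \<otimes>\<^bsub>M\<^esub> (inv\<^bsub>M\<^esub> a \<otimes>\<^bsub>M\<^esub> a) \<otimes>\<^bsub>M\<^esub> c"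
      using that by (simp only: M.m_ac M.inv_closed M.m_closed)
    then show ?thesis using that by simp
  qed
  \<comment> \<open>The inverse is needed because \<open>f (x, y)\<close> is the value of
    \<open>\<phi>\<close> at the product divided by its values at the factors, whereas
    \<open>coboundary1\<close> has the value at the product inverted.\<close>
  define \<psi> where "\<psi> = (\<lambda>x\<in>carrier G. inv\<^bsub>M\<^esub> \<phi> x)"
  have "f p = coboundary1 G M \<psi> p" for p
  proof (cases "p \<in> carrier G \<times> carrier G")
    case True
    then show ?thesis
      by (auto simp: coboundary1_def \<psi>_def carr \<phi>_mult cancel cocycles2_closed[OF f])
  next
    \<comment> \<open>Off the carrier both extensional functions take the value
      \<open>undefined\<close>.\<close>
    case False
    then show ?thesis
      using f by (cases p) (auto simp: coboundary1_def cocycles2_def cochains2_def PiE_iff extensional_def)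
  qed
  then have "f = coboundary1 G M \<psi>" by blast
  moreover have "\<psi> \<in> carrier G \<rightarrow>\<^sub>E carrier M"
    by (auto simp: \<psi>_def carr)
  ultimately show ?thesis
    by (auto simp: coboundaries2_def)
qed

text \<open>The projection of the extension onto \<open>G\<close> has a central divisible kernel.
  Symmetry of \<open>w\<close> lets commutation lift, so the commutator of lifts of \<open>e\<close>
  and \<open>f\<close> supplies the subgroup \<open>T\<close> for the complement, and the complement
  is a multiplicative section.\<close>

lemma symmetric_cocycle_is_coboundary:
  assumes G: "group G" "finite (carrier G)" and M: "comm_group M"
    and divisible: "\<And>k m. k \<in> carrier M \<Longrightarrow> m > 0 \<Longrightarrow> \<exists>l\<in>carrier M. l [^]\<^bsub>M\<^esub> (m::nat) = k"
    and adj: "adjusting_pair G e f"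
    and central: "\<And>x. x \<in> carrier G \<Longrightarrow>
      e \<otimes>\<^bsub>G\<^esub> f \<otimes>\<^bsub>G\<^esub> inv\<^bsub>G\<^esub> e \<otimes>\<^bsub>G\<^esub> inv\<^bsub>G\<^esub> f \<otimes>\<^bsub>G\<^esub> x = x \<otimes>\<^bsub>G\<^esub> (e \<otimes>\<^bsub>G\<^esub> f \<otimes>\<^bsub>G\<^esub> inv\<^bsub>G\<^esub> e \<otimes>\<^bsub>G\<^esub> inv\<^bsub>G\<^esub> f)"
    and w: "w \<in> cocycles2 G M"
    and sym: "\<And>x y. x \<in> carrier G \<Longrightarrow> y \<in> carrier G \<Longrightarrow>
      x \<otimes>\<^bsub>G\<^esub> y = y \<otimes>\<^bsub>G\<^esub> x \<Longrightarrow> w (x, y) = w (y, x)"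
  shows "w \<in> coboundaries2 G M"
proof -
  let ?E = "central_extension G M w"
  interpret G: group G by fact
  interpret M: comm_group M by fact
  interpret E: group ?E
    by (rule group_central_extension) fact+
  interpret snd: group_hom ?E G snd
    by unfold_locales (auto simp: hom_def)
  have surj: "snd ` carrier ?E = carrier G"
    using M.one_closed by (auto simp: image_iff)
  \<comment> \<open>The two products differ at most by \<open>w (x, y)\<close> against
    \<open>w (y, x)\<close>.\<close>
  have lift: "p \<otimes>\<^bsub>?E\<^esub> q = q \<otimes>\<^bsub>?E\<^esub> p"
    if "p \<in> carrier ?E" "q \<in> carrier ?E" "snd p \<otimes>\<^bsub>G\<^esub> snd q = snd q \<otimes>\<^bsub>G\<^esub> snd p" for p q
    using that sym[of "snd p" "snd q"] by (auto simp: M.m_comm)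
  define e' f' where "e' = (\<one>\<^bsub>M\<^esub>, e)" and "f' = (\<one>\<^bsub>M\<^esub>, f)"
  have ef': "e' \<in> carrier ?E" "f' \<in> carrier ?E" "snd e' = e" "snd f' = f"
    using adj by (auto simp: e'_def f'_def adjusting_pair_def)
  let ?t = "e' \<otimes>\<^bsub>?E\<^esub> f' \<otimes>\<^bsub>?E\<^esub> inv\<^bsub>?E\<^esub> e' \<otimes>\<^bsub>?E\<^esub> inv\<^bsub>?E\<^esub> f'"
  have snd_t: "snd ?t = e \<otimes>\<^bsub>G\<^esub> f \<otimes>\<^bsub>G\<^esub> inv\<^bsub>G\<^esub> e \<otimes>\<^bsub>G\<^esub> inv\<^bsub>G\<^esub> f"
    using ef' by (simp add: snd.hom_mult snd.hom_inv del: central_extension_simps)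
  have adj': "adjusting_pair G (snd e') (snd f')"
    using adj by (simp add: ef')
  have central': "snd ?t \<otimes>\<^bsub>G\<^esub> x = x \<otimes>\<^bsub>G\<^esub> snd ?t" if "x \<in> carrier G" for x
    unfolding snd_t by (rule central[OF that])
  note comm = snd.commutators_in_lifted_commutator[OF adj' ef'(1,2) surj lift refl central']
  have kernel: "kernel ?E G snd = carrier M \<times> {\<one>\<^bsub>G\<^esub>}"
    by (auto simp: kernel_def)
  \<comment> \<open>The shift by the value of \<open>w\<close> at the identities makes this a
    homomorphism from \<open>M\<close> into the kernel, so that roots in \<open>M\<close> yield
    roots in the kernel.\<close>
  define \<iota> where "\<iota> k = (k \<otimes>\<^bsub>M\<^esub> inv\<^bsub>M\<^esub> w (\<one>\<^bsub>G\<^esub>, \<one>\<^bsub>G\<^esub>), \<one>\<^bsub>G\<^esub>)" for k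
  have w1: "w (\<one>\<^bsub>G\<^esub>, \<one>\<^bsub>G\<^esub>) \<in> carrier M"
    by (rule cocycles2_closed[OF w]) simp_all
  have "k \<otimes>\<^bsub>M\<^esub> l \<otimes>\<^bsub>M\<^esub> inv\<^bsub>M\<^esub> a = k \<otimes>\<^bsub>M\<^esub> inv\<^bsub>M\<^esub> a \<otimes>\<^bsub>M\<^esub> (l \<otimes>\<^bsub>M\<^esub> inv\<^bsub>M\<^esub> a) \<otimes>\<^bsub>M\<^esub> a"
    if "k \<in> carrier M" "l \<in> carrier M" "a \<in> carrier M" for k l a
    using that by (simp add: M.m_assoc) (simp add: M.m_lcomm M.m_comm[of "inv\<^bsub>M\<^esub> a" l])
  then interpret \<iota>: group_hom M ?E \<iota>
    by unfold_locales (auto simp: hom_def \<iota>_def w1)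
  have "\<exists>l\<in>kernel ?E G snd. l [^]\<^bsub>?E\<^esub> m = k" if k: "k \<in> kernel ?E G snd" and "m > 0" for k and m :: nat
  proof -
    obtain k' where k': "k' \<in> carrier M" "k = (k', \<one>\<^bsub>G\<^esub>)"
      using k by (auto simp: kernel)
    \<comment> \<open>The factor from \<open>w\<close> undoes the shift in \<open>\<iota>\<close>:
      the map sends \<open>k'\<close> times that factor to \<open>k\<close>.\<close>
    obtain l where l: "l \<in> carrier M" "l [^]\<^bsub>M\<^esub> m = k' \<otimes>\<^bsub>M\<^esub> w (\<one>\<^bsub>G\<^esub>, \<one>\<^bsub>G\<^esub>)"
      using divisible[of "k' \<otimes>\<^bsub>M\<^esub> w (\<one>\<^bsub>G\<^esub>, \<one>\<^bsub>G\<^esub>)" m] k' w1 \<open>m > 0\<close> by auto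
    have "\<iota> l [^]\<^bsub>?E\<^esub> m = \<iota> (l [^]\<^bsub>M\<^esub> m)"
      using l(1) by (simp add: \<iota>.hom_nat_pow)
    also have "\<dots> = k"
      using k' w1 by (simp add: l(2) \<iota>_def M.m_assoc)
    finally show ?thesis
      using l(1) w1 by (intro bexI[of _ "\<iota> l"]) (auto simp: kernel \<iota>_def)
  qed
  moreover have "k \<otimes>\<^bsub>?E\<^esub> p = p \<otimes>\<^bsub>?E\<^esub> k" if "k \<in> kernel ?E G snd" "p \<in> carrier ?E" for k p
    using that by (intro lift) (auto simp: kernel)
  moreover have "subgroup (generate ?E {?t}) ?E"
    using ef' by (intro E.generate_is_subgroup) (simp del: central_extension_simps)
  ultimately obtain S where S: "subgroup S ?E" "bij_betw snd S (carrier G)"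
    using snd.central_divisible_kernel_complement[OF G(2) surj _ _ _ comm] by blast
  show ?thesis
    using S(2) subgroup.subset[OF S(1)] subgroup.m_closed[OF S(1)]
    by (intro cocycle_is_coboundary_if_section[OF M w, of S] G) auto
qed

section \<open>From the Bogomolov multiplier to symmetric cocycles\<close>

text \<open>The class of \<open>a / m\<close> is an \<open>m\<close>-th root of the class of
  \<open>a\<close>.\<close>

lemma QZ_group_divisible:
  assumes "q \<in> carrier QZ_group" and "m > 0"
  shows "\<exists>l\<in>carrier QZ_group. l [^]\<^bsub>QZ_group\<^esub> (m::nat) = q"
proof -
  interpret R: comm_group rat_group by (rule comm_group_rat_group)
  interpret N: normal \<int> rat_group
    by (rule R.subgroup_imp_normal[OF subgroup_Ints_rat_group])
  obtain a where a: "q = \<int> #>\<^bsub>rat_group\<^esub> a"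
    using assms(1) by (auto simp: QZ_group_def carrier_FactGroup)
  have UNIV: "x \<in> carrier rat_group" for x
    by (simp add: rat_group_def)
  have "x [^]\<^bsub>rat_group\<^esub> k = of_nat k * x" for x and k :: nat
    by (induction k) (simp_all add: rat_group_def algebra_simps)
  then have "(\<int> #>\<^bsub>rat_group\<^esub> (a / of_nat m)) [^]\<^bsub>QZ_group\<^esub> m = q"
    using assms(2) by (simp add: QZ_group_def N.FactGroup_pow[OF UNIV] a)
  moreover have "\<int> #>\<^bsub>rat_group\<^esub> (a / of_nat m) \<in> carrier QZ_group"
    by (auto simp: QZ_group_def carrier_FactGroup UNIV)
  ultimately show ?thesis by blast
qed

text \<open>Two centralizer arguments: the generated subgroup centralizes \<open>x\<close> and
  \<open>y\<close>, so \<open>x\<close> and \<open>y\<close> centralize it, and hence it centralizes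
  itself.\<close>

lemma (in group) comm_group_generate_commuting_pair:
  assumes "x \<in> carrier G" "y \<in> carrier G" "x \<otimes> y = y \<otimes> x"
  shows "comm_group (G\<lparr>carrier := generate G {x, y}\<rparr>)"
proof -
  let ?A = "generate G {x, y}"
  have sub: "subgroup ?A G" and carr: "?A \<subseteq> carrier G"
    using assms by (auto intro!: generate_is_subgroup generate_incl)
  have "?A \<subseteq> {u \<in> carrier G. \<forall>b\<in>{x, y}. u \<otimes> b = b \<otimes> u}"
    using assms by (intro generate_subgroup_incl subgroup_centralizer) auto
  then have "?A \<subseteq> {u \<in> carrier G. \<forall>b\<in>?A. u \<otimes> b = b \<otimes> u}"
    using assms by (intro generate_subgroup_incl[OF _ subgroup_centralizer[OF carr]]) auto
  then show ?thesis
    by (intro group.group_comm_groupI subgroup_imp_group sub) auto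
qed

lemma coboundaries2_sym:
  assumes "comm_group A" "comm_group M" "f \<in> coboundaries2 A M" "x \<in> carrier A" "y \<in> carrier A"
  shows "f (x, y) = f (y, x)"
proof -
  interpret A: comm_group A by fact
  interpret M: comm_group M by fact
  obtain \<phi> where "\<phi> \<in> carrier A \<rightarrow>\<^sub>E carrier M" "f = coboundary1 A M \<phi>"
    using assms(3) by (auto simp: coboundaries2_def)
  moreover from this have "\<phi> z \<in> carrier M" if "z \<in> carrier A" for z
    using that by auto
  ultimately show ?thesis
    using assms(4,5) by (simp add: coboundary1_def A.m_comm M.m_ac)
qed

text \<open>On the abelian subgroup generated by \<open>x\<close> and \<open>y\<close> the cocycle
  is a coboundary, and coboundaries on abelian groups are symmetric.\<close>

lemma bogomolov_multiplier_cocycle_sym: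
  assumes G: "group G" and f: "f \<in> cocycles2 G QZ_group"
    and X: "coboundaries2 G QZ_group #>\<^bsub>cochains2 G QZ_group\<^esub> f \<in> bogomolov_multiplier G"
    and xy: "x \<in> carrier G" "y \<in> carrier G" "x \<otimes>\<^bsub>G\<^esub> y = y \<otimes>\<^bsub>G\<^esub> x"
  shows "f (x, y) = f (y, x)"
proof -
  interpret G: group G by fact
  let ?A = "generate G {x, y}"
  let ?GA = "G\<lparr>carrier := ?A\<rparr>"
  have sub: "subgroup ?A G"
    using xy by (intro G.generate_is_subgroup) simp
  have comm: "comm_group ?GA"
    by (rule G.comm_group_generate_commuting_pair) fact+
  have A: "x \<in> ?A" "y \<in> ?A"
    by (auto intro: generate.incl)
  have gA: "group ?GA"
    by (rule G.subgroup_imp_group[OF sub])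
  let ?Z = "(cochains2 ?GA QZ_group)\<lparr>carrier := cocycles2 ?GA QZ_group\<rparr>"
  interpret Z: comm_group ?Z
    by (rule comm_group_cocycles2[OF gA comm_group_QZ_group])
  have "res2 G ?A QZ_group (coboundaries2 G QZ_group #>\<^bsub>cochains2 G QZ_group\<^esub> f) = \<one>\<^bsub>H2 ?GA QZ_group\<^esub>"
    using X sub comm by (auto simp: bogomolov_multiplier_def kernel_def)
  then have "coboundaries2 ?GA QZ_group #>\<^bsub>?Z\<^esub> restrict f (?A \<times> ?A) = coboundaries2 ?GA QZ_group"
    unfolding res2_coset[OF G sub comm_group_QZ_group f] by (simp add: H2_def FactGroup_def r_coset_def)
  then have "restrict f (?A \<times> ?A) \<in> coboundaries2 ?GA QZ_group"
    using Z.rcos_self[OF _ subgroup_coboundaries2[OF gA comm_group_QZ_group]]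
      restrict_cocycles2[OF G sub f] by auto
  from coboundaries2_sym[OF comm comm_group_QZ_group this, of x y] A show ?thesis
    by simp
qed

text \<open>A representing cocycle of a class in the multiplier is symmetric on commuting pairs,
  hence a coboundary by the splitting of its extension.\<close>

theorem bogomolov_multiplier_trivial:
  assumes G: "group G" "finite (carrier G)" and adj: "adjusting_pair G e f"
    and central: "\<And>x. x \<in> carrier G \<Longrightarrow>
      e \<otimes>\<^bsub>G\<^esub> f \<otimes>\<^bsub>G\<^esub> inv\<^bsub>G\<^esub> e \<otimes>\<^bsub>G\<^esub> inv\<^bsub>G\<^esub> f \<otimes>\<^bsub>G\<^esub> x = x \<otimes>\<^bsub>G\<^esub> (e \<otimes>\<^bsub>G\<^esub> f \<otimes>\<^bsub>G\<^esub> inv\<^bsub>G\<^esub> e \<otimes>\<^bsub>G\<^esub> inv\<^bsub>G\<^esub> f)"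
  shows "bogomolov_multiplier G = {\<one>\<^bsub>H2 G QZ_group\<^esub>}"
proof (intro equalityI subsetI)
  interpret G: group G by fact
  let ?Z = "(cochains2 G QZ_group)\<lparr>carrier := cocycles2 G QZ_group\<rparr>"
  interpret Z: comm_group ?Z
    by (rule comm_group_cocycles2[OF G(1) comm_group_QZ_group])
  fix X assume X: "X \<in> bogomolov_multiplier G"
  \<comment> \<open>One abelian subgroup, here the trivial one, is enough to see that
    \<open>X\<close> is a cohomology class.\<close>
  have "subgroup {\<one>\<^bsub>G\<^esub>} G" "comm_group (G\<lparr>carrier := {\<one>\<^bsub>G\<^esub>}\<rparr>)"
    using G.triv_subgroup by (auto intro!: group.group_comm_groupI G.subgroup_imp_group)
  then have "X \<in> carrier (H2 G QZ_group)"
    using X by (auto simp: bogomolov_multiplier_def kernel_def)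
  then obtain w where w: "w \<in> cocycles2 G QZ_group"
    and X_eq: "X = coboundaries2 G QZ_group #>\<^bsub>cochains2 G QZ_group\<^esub> w"
    by (auto simp: H2_def carrier_FactGroup r_coset_def)
  have "w \<in> coboundaries2 G QZ_group"
    using bogomolov_multiplier_cocycle_sym[OF G(1) w X[unfolded X_eq]]
    by (intro symmetric_cocycle_is_coboundary[OF G comm_group_QZ_group QZ_group_divisible adj central w])
  then have "coboundaries2 G QZ_group #>\<^bsub>?Z\<^esub> w = coboundaries2 G QZ_group"
    using w by (intro Z.coset_join2 subgroup_coboundaries2 G comm_group_QZ_group) auto
  then show "X \<in> {\<one>\<^bsub>H2 G QZ_group\<^esub>}"
    by (simp add: X_eq H2_def r_coset_def)
next
  fix X assume "X \<in> {\<one>\<^bsub>H2 G QZ_group\<^esub>}"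
  then have X: "X = \<one>\<^bsub>H2 G QZ_group\<^esub>" by simp
  \<comment> \<open>Restriction is a homomorphism, so every kernel contains the identity.\<close>
  have "X \<in> kernel (H2 G QZ_group) (H2 (G\<lparr>carrier := A\<rparr>) QZ_group) (res2 G A QZ_group)"
    if A: "subgroup A G" for A
  proof -
    have "group_hom (H2 G QZ_group) (H2 (G\<lparr>carrier := A\<rparr>) QZ_group) (res2 G A QZ_group)"
      using comm_group_H2[OF G(1) comm_group_QZ_group] res2_hom[OF G(1) A comm_group_QZ_group]
        comm_group_H2[OF group.subgroup_imp_group[OF G(1) A] comm_group_QZ_group]
      by (simp add: group_hom_def group_hom_axioms_def comm_group_def)
    then show ?thesis
      unfolding X using group_hom.subgroup_kernel subgroup.one_closed by blast
  qed
  then show "X \<in> bogomolov_multiplier G"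
    by (auto simp: bogomolov_multiplier_def)
qed

section \<open>Computations in the Heisenberg group\<close>

declare One_nat_def [simp del]

text \<open>Reduction modulo \<open>r\<close> keeps the vector in the carrier for every integer
  \<open>k\<close> when \<open>r > 0\<close>; for \<open>r = 1\<close> even the entry 1 would be out
  of range.\<close>

definition coord1 :: "nat \<Rightarrow> nat \<Rightarrow> int \<Rightarrow> nat \<Rightarrow> int" where
  "coord1 n r k = (\<lambda>i\<in>{1..n}. if i = 1 then k mod int r else 0)"

lemma heisenberg_carrier:
  assumes "r > 0"
  shows "(a, b, c) \<in> carrier (heisenberg_group d n r) \<longleftrightarrow>
    a \<in> {0..<int r} \<and> b \<in> {1..n} \<rightarrow>\<^sub>E {0..<int r} \<and> c \<in> {1..n} \<rightarrow>\<^sub>E {0..<int r}"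
  using assms by (simp add: heisenberg_group_def carrier_integer_mod_group)

lemma heisenberg_mult:
  "(a, b, c) \<otimes>\<^bsub>heisenberg_group d n r\<^esub> (a', b', c') =
    ((a + a' + (\<Sum>i=1..n. int (d i) * b' i * c i)) mod int r,
     \<lambda>i\<in>{1..n}. (b i + b' i) mod int r, \<lambda>i\<in>{1..n}. (c i + c' i) mod int r)"
  by (simp add: heisenberg_group_def Let_def)

text \<open>The two products can differ only in the first component, where the common
  \<open>a + a'\<close> cancels.\<close>

lemma heisenberg_commute_iff:
  "(a, b, c) \<otimes>\<^bsub>heisenberg_group d n r\<^esub> (a', b', c') = (a', b', c') \<otimes>\<^bsub>heisenberg_group d n r\<^esub> (a, b, c) \<longleftrightarrow>
    [(\<Sum>i=1..n. int (d i) * b' i * c i) = (\<Sum>i=1..n. int (d i) * b i * c' i)] (mod int r)"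
proof -
  have "(a + a' + s) mod int r = (a + a' + t) mod int r \<longleftrightarrow> s mod int r = t mod int r" for s t
    using cong_add_lcancel[of "a + a'" s t "int r"] by (simp only: cong_def)
  moreover have "(\<lambda>i\<in>{1..n}. (u i + v i) mod int r) = (\<lambda>i\<in>{1..n}. (v i + u i) mod int r)"
    for u v :: "nat \<Rightarrow> int"
    by (simp add: add.commute)
  ultimately show ?thesis
    unfolding heisenberg_mult prod.inject cong_def add.commute[of a' a] by blast
qed

text \<open>Serves to replace reduced coordinates by unreduced ones in the bilinear sums.\<close>

lemma sum_cong_mod:
  assumes "\<And>i. i \<in> I \<Longrightarrow> [b i = b' i] (mod m)" "\<And>i. i \<in> I \<Longrightarrow> [c i = c' i] (mod m)"
  shows "[(\<Sum>i\<in>I. k i * b i * c i) = (\<Sum>i\<in>I. k i * b' i * c' i)] (mod (m :: int))"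
  using assms by (intro cong_sum cong_mult cong_refl) auto

lemma coord1_closed: "r > 0 \<Longrightarrow> coord1 n r k \<in> {1..n} \<rightarrow>\<^sub>E {0..<int r}"
  by (auto simp: coord1_def)

text \<open>The bilinear term vanishes throughout, since all \<open>c\<close>-coordinates or all
  \<open>b\<close>-coordinates are zero.\<close>

lemma heisenberg_coord_pow:
  assumes "r > 0"
  shows "(0, coord1 n r 1, \<lambda>i\<in>{1..n}. 0) [^]\<^bsub>heisenberg_group d n r\<^esub> (k::nat) =
      (0, coord1 n r (int k), \<lambda>i\<in>{1..n}. 0)"
    and "(0, \<lambda>i\<in>{1..n}. 0, coord1 n r 1) [^]\<^bsub>heisenberg_group d n r\<^esub> k =
      (0, \<lambda>i\<in>{1..n}. 0, coord1 n r (int k))"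
proof -
  have one: "\<one>\<^bsub>heisenberg_group d n r\<^esub> = (0, \<lambda>i\<in>{1..n}. 0, \<lambda>i\<in>{1..n}. 0)"
    by (simp add: heisenberg_group_def Let_def)
  have zero: "coord1 n r 0 = (\<lambda>i\<in>{1..n}. 0)"
    by (auto simp: coord1_def)
  have add: "(\<lambda>i\<in>{1..n}. (coord1 n r x i + coord1 n r y i) mod int r) = coord1 n r (x + y)" for x y
    by (auto simp: coord1_def mod_simps)
  show "(0, coord1 n r 1, \<lambda>i\<in>{1..n}. 0) [^]\<^bsub>heisenberg_group d n r\<^esub> (k::nat) =
      (0, coord1 n r (int k), \<lambda>i\<in>{1..n}. 0)"
  proof (induction k)
    case (Suc k)
    then show ?case
      by (simp add: heisenberg_mult add add.commute cong: restrict_cong) (simp add: restrict_def)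
  qed (simp add: one zero restrict_def)
  show "(0, \<lambda>i\<in>{1..n}. 0, coord1 n r 1) [^]\<^bsub>heisenberg_group d n r\<^esub> k =
      (0, \<lambda>i\<in>{1..n}. 0, coord1 n r (int k))"
  proof (induction k)
    case (Suc k)
    then show ?case
      by (simp add: heisenberg_mult add add.commute cong: restrict_cong) (simp add: restrict_def)
  qed (simp add: one zero restrict_def)
qed

lemma restrict_mod_id:
  assumes "u \<in> I \<rightarrow>\<^sub>E {0..<m}"
  shows "(\<lambda>i\<in>I. u i mod m) = (u :: 'a \<Rightarrow> int)"
  using assms by (intro extensionalityI[of _ I]) (auto simp: PiE_iff)

text \<open>The first component stays unevaluated because \<open>heisenberg_commute_iff\<close> does
  not depend on it.\<close>

lemma heisenberg_mult_coord1:
  assumes "r > 0" "(a, b, c) \<in> carrier (heisenberg_group d n r)"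
  shows "(a, b, c) \<otimes>\<^bsub>heisenberg_group d n r\<^esub> (0, coord1 n r 1, \<lambda>i\<in>{1..n}. 0) [^]\<^bsub>heisenberg_group d n r\<^esub> (k::nat) =
      (fst ((a, b, c) \<otimes>\<^bsub>heisenberg_group d n r\<^esub> (0, coord1 n r (int k), \<lambda>i\<in>{1..n}. 0)),
       \<lambda>i\<in>{1..n}. (b i + (if i = 1 then int k else 0)) mod int r, c)"
    and "(a, b, c) \<otimes>\<^bsub>heisenberg_group d n r\<^esub> (0, \<lambda>i\<in>{1..n}. 0, coord1 n r 1) [^]\<^bsub>heisenberg_group d n r\<^esub> k =
      (fst ((a, b, c) \<otimes>\<^bsub>heisenberg_group d n r\<^esub> (0, \<lambda>i\<in>{1..n}. 0, coord1 n r (int k))),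
       b, \<lambda>i\<in>{1..n}. (c i + (if i = 1 then int k else 0)) mod int r)"
  using assms unfolding heisenberg_coord_pow[OF assms(1)]
  by (auto simp: heisenberg_carrier heisenberg_mult restrict_mod_id coord1_def mod_simps cong: restrict_cong)

text \<open>By \<open>heisenberg_commute_iff\<close> each condition is a congruence of bilinear sums
  modulo \<open>r\<close>. Powers of \<open>e\<close> and \<open>f\<close> shift \<open>b 1\<close>
  and \<open>c 1\<close> freely, so these congruences can be solved.\<close>

lemma adjusting_pair_heisenberg:
  assumes "r > 0" "n > 0" and dvd: "\<And>i. i \<in> {1..n} \<Longrightarrow> d 1 dvd d i"
  shows "adjusting_pair (heisenberg_group d n r)
    (0, coord1 n r 1, \<lambda>i\<in>{1..n}. 0) (0, \<lambda>i\<in>{1..n}. 0, coord1 n r 1)"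
proof -
  let ?H = "heisenberg_group d n r"
  let ?e = "(0, coord1 n r 1, \<lambda>i\<in>{1..n}. 0) :: int \<times> (nat \<Rightarrow> int) \<times> (nat \<Rightarrow> int)"
  let ?f = "(0, \<lambda>i\<in>{1..n}. 0, coord1 n r 1) :: int \<times> (nat \<Rightarrow> int) \<times> (nat \<Rightarrow> int)"
  let ?\<delta> = "\<lambda>(k::int) (i::nat). if i = 1 then k else 0"
  \<comment> \<open>Exponents must be natural numbers but matter only modulo \<open>r\<close>, so
    any integer can be prescribed.\<close>
  have nat: "\<exists>m::nat. [int m = k] (mod int r)" for k
    using assms(1) by (intro exI[of _ "nat (k mod int r)"]) (simp add: cong_def)
  have coord1: "[coord1 n r k i = ?\<delta> k i] (mod int r)" if "i \<in> {1..n}" for k i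
    using that by (simp add: coord1_def cong_def)
  have \<delta>_left: "(\<Sum>i=1..n. int (d i) * ?\<delta> k i * u i) = int (d 1) * k * u 1" for k u
  proof -
    have "(\<Sum>i=1..n. int (d i) * ?\<delta> k i * u i) = (\<Sum>i=1..n. if i = 1 then int (d 1) * k * u 1 else 0)"
      by (intro sum.cong) auto
    then show ?thesis using \<open>n > 0\<close> by simp
  qed
  have \<delta>_right: "(\<Sum>i=1..n. int (d i) * u i * ?\<delta> k i) = int (d 1) * u 1 * k" for k u
  proof -
    have "(\<Sum>i=1..n. int (d i) * u i * ?\<delta> k i) = (\<Sum>i=1..n. if i = 1 then int (d 1) * u 1 * k else 0)"
      by (intro sum.cong) auto
    then show ?thesis using \<open>n > 0\<close> by simp
  qed
  show ?thesis
    unfolding adjusting_pair_def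
  proof (intro conjI ballI)
    show "?e \<in> carrier ?H" "?f \<in> carrier ?H"
      using assms(1) coord1_closed[OF assms(1), of n 1] by (simp_all add: heisenberg_carrier)
  next
    fix x assume x: "x \<in> carrier ?H"
    obtain a b c where eq: "x = (a, b, c)" by (metis prod_cases3)
    \<comment> \<open>Commuting with \<open>f\<close> requires \<open>d 1 * (b 1 + k)\<close> to
      vanish modulo \<open>r\<close>; the case of \<open>e\<close> below is the same with
      \<open>c 1\<close>.\<close>
    obtain k :: nat where k: "[int k = - b 1] (mod int r)" using nat by blast
    have "[(\<Sum>i=1..n. int (d i) * (\<lambda>i\<in>{1..n}. (b i + ?\<delta> (int k) i) mod int r) i * coord1 n r 1 i) =
        (\<Sum>i=1..n. int (d i) * (b i + ?\<delta> (int k) i) * ?\<delta> 1 i)] (mod int r)"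
      by (intro sum_cong_mod coord1) auto
    also have "(\<Sum>i=1..n. int (d i) * (b i + ?\<delta> (int k) i) * ?\<delta> 1 i) = int (d 1) * (b 1 + int k) * 1"
      unfolding \<delta>_right by simp
    also have "[\<dots> = int (d 1) * (b 1 + - b 1) * 1] (mod int r)"
      by (intro cong_mult cong_add cong_refl k)
    finally show "\<exists>i::nat. x \<otimes>\<^bsub>?H\<^esub> ?e [^]\<^bsub>?H\<^esub> i \<otimes>\<^bsub>?H\<^esub> ?f = ?f \<otimes>\<^bsub>?H\<^esub> (x \<otimes>\<^bsub>?H\<^esub> ?e [^]\<^bsub>?H\<^esub> i)"
      using x unfolding eq
      by (intro exI[of _ k]) (simp add: heisenberg_mult_coord1[OF assms(1)] heisenberg_commute_iff cong_sym_eq)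
  next
    fix x assume x: "x \<in> carrier ?H"
    obtain a b c where eq: "x = (a, b, c)" by (metis prod_cases3)
    obtain k :: nat where k: "[int k = - c 1] (mod int r)" using nat by blast
    have "[(\<Sum>i=1..n. int (d i) * coord1 n r 1 i * (\<lambda>i\<in>{1..n}. (c i + ?\<delta> (int k) i) mod int r) i) =
        (\<Sum>i=1..n. int (d i) * ?\<delta> 1 i * (c i + ?\<delta> (int k) i))] (mod int r)"
      by (intro sum_cong_mod coord1) auto
    also have "(\<Sum>i=1..n. int (d i) * ?\<delta> 1 i * (c i + ?\<delta> (int k) i)) = int (d 1) * 1 * (c 1 + int k)"
      unfolding \<delta>_left by simp
    also have "[\<dots> = int (d 1) * 1 * (c 1 + - c 1)] (mod int r)"
      by (intro cong_mult cong_add cong_refl k)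
    finally show "\<exists>j::nat. x \<otimes>\<^bsub>?H\<^esub> ?f [^]\<^bsub>?H\<^esub> j \<otimes>\<^bsub>?H\<^esub> ?e = ?e \<otimes>\<^bsub>?H\<^esub> (x \<otimes>\<^bsub>?H\<^esub> ?f [^]\<^bsub>?H\<^esub> j)"
      using x unfolding eq
      by (intro exI[of _ k]) (simp add: heisenberg_mult_coord1[OF assms(1)] heisenberg_commute_iff)
  next
    fix x y assume xy: "x \<in> carrier ?H" "y \<in> carrier ?H"
    obtain a b c where x: "x = (a, b, c)" by (metis prod_cases3)
    obtain a' b' c' where y: "y = (a', b', c')" by (metis prod_cases3)
    \<comment> \<open>This difference is the obstruction to \<open>x\<close> and \<open>y\<close>
      commuting; each of its terms is a multiple of \<open>d 1\<close>.\<close>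
    have "int (d 1) dvd (\<Sum>i=1..n. int (d i) * b' i * c i) - (\<Sum>i=1..n. int (d i) * b i * c' i)"
      using dvd by (intro dvd_diff dvd_sum) auto
    then obtain q where "(\<Sum>i=1..n. int (d i) * b' i * c i) - (\<Sum>i=1..n. int (d i) * b i * c' i) =
        int (d 1) * q"
      by (rule dvdE)
    then have q: "(\<Sum>i=1..n. int (d i) * b' i * c i) = (\<Sum>i=1..n. int (d i) * b i * c' i) + int (d 1) * q"
      by linarith
    \<comment> \<open>the power of \<open>f\<close> makes the first \<open>c\<close>-coordinate of \<open>y\<close> equal to 1, so that the power of \<open>e\<close>
      can absorb the multiple \<open>q\<close> of \<open>d\<^sub>1\<close>\<close>
    obtain l :: nat where l: "[int l = 1 - c' 1] (mod int r)" using nat by blast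
    obtain k :: nat where k: "[int k = q - b 1 * (1 - c' 1)] (mod int r)" using nat by blast
    have "[(\<Sum>i=1..n. int (d i) * (\<lambda>i\<in>{1..n}. (b i + ?\<delta> (int k) i) mod int r) i *
          (\<lambda>i\<in>{1..n}. (c' i + ?\<delta> (int l) i) mod int r) i) =
        (\<Sum>i=1..n. int (d i) * (b i + ?\<delta> (int k) i) * (c' i + ?\<delta> (int l) i))] (mod int r)"
      by (intro sum_cong_mod) auto
    \<comment> \<open>Only first coordinates are shifted, so every new term carries the factor
      \<open>d 1\<close>.\<close>
    also have "(\<Sum>i=1..n. int (d i) * (b i + ?\<delta> (int k) i) * (c' i + ?\<delta> (int l) i)) =
        (\<Sum>i=1..n. int (d i) * b i * c' i) + (\<Sum>i=1..n. int (d i) * ?\<delta> (int k) i * (c' i + ?\<delta> (int l) i))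
        + (\<Sum>i=1..n. int (d i) * b i * ?\<delta> (int l) i)"
      unfolding sum.distrib[symmetric] by (intro sum.cong) (auto simp: algebra_simps)
    also have "\<dots> = (\<Sum>i=1..n. int (d i) * b i * c' i) + int (d 1) * (int k * (c' 1 + int l) + b 1 * int l)"
      unfolding \<delta>_left \<delta>_right by (simp add: algebra_simps)
    also have "[\<dots> = (\<Sum>i=1..n. int (d i) * b i * c' i) +
        int (d 1) * ((q - b 1 * (1 - c' 1)) * (c' 1 + (1 - c' 1)) + b 1 * (1 - c' 1))] (mod int r)"
      by (intro cong_mult cong_add cong_refl k l)
    also have "(q - b 1 * (1 - c' 1)) * (c' 1 + (1 - c' 1)) + b 1 * (1 - c' 1) = q"
      by (simp add: algebra_simps)
    finally show "\<exists>(i::nat) (j::nat). x \<otimes>\<^bsub>?H\<^esub> ?e [^]\<^bsub>?H\<^esub> i \<otimes>\<^bsub>?H\<^esub> (y \<otimes>\<^bsub>?H\<^esub> ?f [^]\<^bsub>?H\<^esub> j) =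
        y \<otimes>\<^bsub>?H\<^esub> ?f [^]\<^bsub>?H\<^esub> j \<otimes>\<^bsub>?H\<^esub> (x \<otimes>\<^bsub>?H\<^esub> ?e [^]\<^bsub>?H\<^esub> i)"
      using xy unfolding x y
      by (intro exI[of _ k] exI[of _ l])
        (simp add: heisenberg_mult_coord1[OF assms(1)] heisenberg_commute_iff q cong_sym_eq)
  qed
qed

text \<open>The \<open>b\<close>- and \<open>c\<close>-coordinates add commutatively, so those of a
  commutator vanish modulo \<open>r\<close>, and with them its bilinear sums with any
  \<open>z\<close>.\<close>

lemma heisenberg_commutator_central:
  assumes "r > 0" and x: "x \<in> carrier (heisenberg_group d n r)"
    and y: "y \<in> carrier (heisenberg_group d n r)" and z: "z \<in> carrier (heisenberg_group d n r)"
  shows "x \<otimes>\<^bsub>heisenberg_group d n r\<^esub> y \<otimes>\<^bsub>heisenberg_group d n r\<^esub> inv\<^bsub>heisenberg_group d n r\<^esub> x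
        \<otimes>\<^bsub>heisenberg_group d n r\<^esub> inv\<^bsub>heisenberg_group d n r\<^esub> y \<otimes>\<^bsub>heisenberg_group d n r\<^esub> z =
      z \<otimes>\<^bsub>heisenberg_group d n r\<^esub> (x \<otimes>\<^bsub>heisenberg_group d n r\<^esub> y \<otimes>\<^bsub>heisenberg_group d n r\<^esub>
        inv\<^bsub>heisenberg_group d n r\<^esub> x \<otimes>\<^bsub>heisenberg_group d n r\<^esub> inv\<^bsub>heisenberg_group d n r\<^esub> y)"
proof -
  let ?H = "heisenberg_group d n r"
  interpret H: group ?H by (rule group_heisenberg_group[OF assms(1)])
  let ?t = "x \<otimes>\<^bsub>?H\<^esub> y \<otimes>\<^bsub>?H\<^esub> inv\<^bsub>?H\<^esub> x \<otimes>\<^bsub>?H\<^esub> inv\<^bsub>?H\<^esub> y"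
  obtain a b c where t: "?t = (a, b, c)" by (metis prod_cases3)
  obtain a1 b1 c1 where x': "x = (a1, b1, c1)" by (metis prod_cases3)
  obtain a2 b2 c2 where y': "y = (a2, b2, c2)" by (metis prod_cases3)
  obtain a3 b3 c3 where z': "z = (a3, b3, c3)" by (metis prod_cases3)
  \<comment> \<open>Comparing coordinates in this equation avoids computing inverses.\<close>
  have "?t \<otimes>\<^bsub>?H\<^esub> (y \<otimes>\<^bsub>?H\<^esub> x) = x \<otimes>\<^bsub>?H\<^esub> y"
    using x y by (simp add: H.m_assoc H.inv_solve_left')
  then have "(a, b, c) \<otimes>\<^bsub>?H\<^esub> (y \<otimes>\<^bsub>?H\<^esub> x) = x \<otimes>\<^bsub>?H\<^esub> y"
    by (simp only: t)
  then have "(\<lambda>i\<in>{1..n}. (b i + (b1 i + b2 i)) mod int r) = (\<lambda>i\<in>{1..n}. (b1 i + b2 i) mod int r)"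
    "(\<lambda>i\<in>{1..n}. (c i + (c1 i + c2 i)) mod int r) = (\<lambda>i\<in>{1..n}. (c1 i + c2 i) mod int r)"
    unfolding x' y' heisenberg_mult prod.inject
    by (simp_all add: mod_simps add.commute[of "b1 i" for i] add.commute[of "c1 i" for i] cong: restrict_cong)
  then have "[b i + (b1 i + b2 i) = b1 i + b2 i] (mod int r)" "[c i + (c1 i + c2 i) = c1 i + c2 i] (mod int r)"
    if "i \<in> {1..n}" for i
    using that by (auto simp: cong_def dest!: fun_cong[of _ _ i])
  then have 0: "[b i = 0] (mod int r)" "[c i = 0] (mod int r)" if "i \<in> {1..n}" for i
    using that by (simp_all add: cong_add_rcancel_0)
  have "[(\<Sum>i=1..n. int (d i) * b3 i * c i) = (\<Sum>i=1..n. int (d i) * b3 i * 0)] (mod int r)"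
    "[(\<Sum>i=1..n. int (d i) * b i * c3 i) = (\<Sum>i=1..n. int (d i) * 0 * c3 i)] (mod int r)"
    by (intro sum_cong_mod cong_refl 0; assumption)+
  then have "(a, b, c) \<otimes>\<^bsub>?H\<^esub> z = z \<otimes>\<^bsub>?H\<^esub> (a, b, c)"
    unfolding z' heisenberg_commute_iff by (simp add: cong_def)
  then show ?thesis
    by (simp only: t)
qed

theorem theorem4p4:
  fixes r n :: nat and d :: "nat \<Rightarrow> nat"
  assumes "r \<ge> 1" and "n \<ge> 1"
    and "\<And>i. i \<in> {1..n} \<Longrightarrow> d i > 0"
    and "\<And>i. i \<in> {1..<n} \<Longrightarrow> d i dvd d (Suc i)"
    and "d n dvd r"
  shows "bogomolov_multiplier (heisenberg_group d n r) =
    {\<one>\<^bsub>H2 (heisenberg_group d n r) QZ_group\<^esub>}"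
proof -
  have pos: "r > 0" "n > 0"
    using assms(1,2) by simp_all
  have "d 1 dvd d i" if "1 \<le> i" "i \<le> n" for i
    using that by (induction i rule: dec_induct) (auto intro: dvd_trans[OF _ assms(4)])
  then have adj: "adjusting_pair (heisenberg_group d n r)
      (0, coord1 n r 1, \<lambda>i\<in>{1..n}. 0) (0, \<lambda>i\<in>{1..n}. 0, coord1 n r 1)"
    by (intro adjusting_pair_heisenberg pos) auto
  show ?thesis
    using adj pos(1)
    by (intro bogomolov_multiplier_trivial[OF _ _ adj] group_heisenberg_group
        finite_heisenberg_group heisenberg_commutator_central) (auto simp: adjusting_pair_def)
qed

end
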